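(* There are absolute constants $C, C' > 0$ such that the following holds. Let $K \ge 2$ and let $A \subseteq \mathbb{Z}$ be a finite nonempty set with additive energy $E(A) \ge |A|^3 / K$. Then there is a subset $X \subseteq A$ with $\dim(X) \le C \log K$ and $|A|/|X| \le C' \exp(C \log^2 K)$.
   Context: The additive energy of a finite set $A$ in an abelian group is $E(A) = \#\{(x,y,z,w) \in A^4 : x - y = z - w\}$. For abelian groups $G, G'$ and finite $A \subseteq G$, $A' \subseteq G'$, a map $\phi: A \to A'$ is a Freiman homomorphism if $\phi(x)+\phi(w) = \phi(y)+\phi(z)$ whenever $x,y,z,w \in A$ satisfy $x + w = y + z$; it is a Freiman isomorphism if it has an inverse which is a Freiman homomorphism. For finite $A \subseteq \mathbb{Z}$, the Freiman dimension $\dim(A)$ is the largest positive integer $d$ such that there exists $A' \subseteq \mathbb{Z}^d$, not contained in any proper affine subspace of $\mathbb{Z}^d$ (i.e. $A'$ affinely generates $\mathbb{Z}^d$), with $A$ Freiman isomorphic to $A'$. *)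

theory Defs
  imports
    Complex_Main
    "HOL-Library.Function_Algebras"
    "HOL-Computational_Algebra.Group_Closure"
begin

definition additive_energy :: "'a::ab_group_add set \<Rightarrow> nat" where
  "additive_energy A =
     card {(x, y, z, w). x \<in> A \<and> y \<in> A \<and> z \<in> A \<and> w \<in> A \<and> x - y = z - w}"

definition freiman_hom ::
    "'a::ab_group_add set \<Rightarrow> 'b::ab_group_add set \<Rightarrow> ('a \<Rightarrow> 'b) \<Rightarrow> bool" where
  "freiman_hom A B \<phi> \<longleftrightarrow>
     \<phi> ` A \<subseteq> B \<and>
     (\<forall>x\<in>A. \<forall>y\<in>A. \<forall>z\<in>A. \<forall>w\<in>A. x + w = y + z \<longrightarrow> \<phi> x + \<phi> w = \<phi> y + \<phi> z)"

definition freiman_iso ::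
    "'a::ab_group_add set \<Rightarrow> 'b::ab_group_add set \<Rightarrow> ('a \<Rightarrow> 'b) \<Rightarrow> bool" where
  "freiman_iso A B \<phi> \<longleftrightarrow>
     freiman_hom A B \<phi> \<and>
     (\<exists>\<psi>. freiman_hom B A \<psi> \<and> (\<forall>x\<in>A. \<psi> (\<phi> x) = x) \<and> (\<forall>y\<in>B. \<phi> (\<psi> y) = y))"

definition freiman_isomorphic :: "'a::ab_group_add set \<Rightarrow> 'b::ab_group_add set \<Rightarrow> bool" where
  "freiman_isomorphic A B \<longleftrightarrow> (\<exists>\<phi>. freiman_iso A B \<phi>)"

text \<open>The group $\mathbb{Z}^d$, for a dimension that varies inside formulas: integer sequences
  supported on the first \<open>d\<close> coordinates, with pointwise addition.\<close>

definition int_lattice :: "nat \<Rightarrow> (nat \<Rightarrow> int) set" where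
  "int_lattice d = {v. \<forall>i\<ge>d. v i = 0}"

text \<open>Affine subspaces are taken over the integers: they are the translates of subgroups. With this
  reading, lying in no proper affine subspace is the same as generating the lattice affinely; see
  \<open>affinely_generates_iff\<close> below.\<close>

definition int_affine_subspace :: "nat \<Rightarrow> (nat \<Rightarrow> int) set \<Rightarrow> bool" where
  "int_affine_subspace d S \<longleftrightarrow>
     (\<exists>a H. a \<in> int_lattice d \<and> H \<subseteq> int_lattice d \<and>
            0 \<in> H \<and> (\<forall>u\<in>H. \<forall>v\<in>H. u - v \<in> H) \<and> S = (\<lambda>h. a + h) ` H)"

definition affinely_generates :: "nat \<Rightarrow> (nat \<Rightarrow> int) set \<Rightarrow> bool" where
  "affinely_generates d B \<longleftrightarrow>
     B \<subseteq> int_lattice d \<and> \<not> (\<exists>S. int_affine_subspace d S \<and> S \<noteq> int_lattice d \<and> B \<subseteq> S)"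

text \<open>For a finite set the supremum is over a finite set of dimensions
  (\<open>finite_freiman_dims\<close> below), so it is the maximum whenever some positive dimension
  is admissible. A one-element set has no admissible positive dimension and gets the value 0.\<close>

definition freiman_dim :: "int set \<Rightarrow> nat" where
  "freiman_dim A = Sup {d. 0 < d \<and> (\<exists>B. affinely_generates d B \<and> freiman_isomorphic A B)}"

lemma int_lattice_diff: "u \<in> int_lattice d \<Longrightarrow> v \<in> int_lattice d \<Longrightarrow> u - v \<in> int_lattice d"
  by (simp add: int_lattice_def)

lemma int_lattice_add: "u \<in> int_lattice d \<Longrightarrow> v \<in> int_lattice d \<Longrightarrow> u + v \<in> int_lattice d"
  by (simp add: int_lattice_def)

lemma affinely_generates_iff:
  assumes "b \<in> B" "B \<subseteq> int_lattice d"
  shows "affinely_generates d B \<longleftrightarrow> group_closure ((\<lambda>x. x - b) ` B) = int_lattice d"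
proof
  define G where "G = group_closure ((\<lambda>x. x - b) ` B)"
  have bL: "b \<in> int_lattice d" using assms by blast
  have GL: "G \<subseteq> int_lattice d"
  proof
    fix g assume "g \<in> G"
    then show "g \<in> int_lattice d" unfolding G_def
    proof (induction rule: group_closure.induct)
      case (base s)
      then show ?case using assms bL int_lattice_diff by (auto simp: int_lattice_def)
    qed (rule int_lattice_diff)
  qed
  show "group_closure ((\<lambda>x. x - b) ` B) = int_lattice d" if gen: "affinely_generates d B"
  proof -
    let ?S = "(\<lambda>h. b + h) ` G"
    have "int_affine_subspace d ?S"
      unfolding int_affine_subspace_def using bL GL
      by (intro exI[of _ b] exI[of _ G]) (auto simp: G_def intro: group_closure.diff)
    moreover have "B \<subseteq> ?S"
    proof
      fix x assume "x \<in> B"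
      then have "x - b \<in> G" unfolding G_def by (intro group_closure.base) auto
      then show "x \<in> ?S" by (intro image_eqI[of _ _ "x - b"]) auto
    qed
    ultimately have S: "?S = int_lattice d" using gen unfolding affinely_generates_def by blast
    have "v \<in> G" if "v \<in> int_lattice d" for v
    proof -
      have "b + v \<in> ?S" using S int_lattice_add[OF bL that] by simp
      then show ?thesis by auto
    qed
    then show ?thesis using GL G_def by blast
  qed
  show "affinely_generates d B" if G: "group_closure ((\<lambda>x. x - b) ` B) = int_lattice d"
    unfolding affinely_generates_def
  proof (intro conjI notI)
    show "B \<subseteq> int_lattice d" by fact
    assume "\<exists>S. int_affine_subspace d S \<and> S \<noteq> int_lattice d \<and> B \<subseteq> S"
    then obtain S where S: "int_affine_subspace d S" "S \<noteq> int_lattice d" "B \<subseteq> S"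
      by blast
    obtain a H where aH0: "a \<in> int_lattice d" "H \<subseteq> int_lattice d" "0 \<in> H"
        "\<forall>u\<in>H. \<forall>v\<in>H. u - v \<in> H" "S = (\<lambda>h. a + h) ` H"
      using S(1) unfolding int_affine_subspace_def by (elim exE conjE)
    have aH: "a \<in> int_lattice d" "H \<subseteq> int_lattice d" "0 \<in> H"
        "u \<in> H \<Longrightarrow> v \<in> H \<Longrightarrow> u - v \<in> H"
        "(\<lambda>h. a + h) ` H \<noteq> int_lattice d" "B \<subseteq> (\<lambda>h. a + h) ` H" for u v
      using aH0 S(2,3) by simp_all
    have "g \<in> H" if "g \<in> group_closure ((\<lambda>x. x - b) ` B)" for g
      using that
    proof (induction rule: group_closure.induct)
      case (base s)
      then consider "s = 0" | x where "x \<in> B" "s = x - b" by blast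
      then show ?case
      proof cases
        case 2
        obtain h k where "x = a + h" "h \<in> H" "b = a + k" "k \<in> H" using 2 aH(6) assms(1) by blast
        then have "s = h - k" "h - k \<in> H" using 2 aH(4)[of h k] by (simp_all only: add_diff_cancel_left)
        then show ?thesis by (simp only:)
      qed (simp only: aH(3))
    qed (rule aH(4))
    then have HL: "H = int_lattice d" using G aH(2) by blast
    have "v \<in> (\<lambda>h. a + h) ` H" if "v \<in> int_lattice d" for v
      using int_lattice_diff[OF that aH(1)] HL by (intro image_eqI[of _ _ "v - a"]) auto
    moreover have "(\<lambda>h. a + h) ` H \<subseteq> int_lattice d"
      using aH(2) by (intro image_subsetI int_lattice_add[OF aH(1)]) (rule subsetD)
    ultimately show False using aH(5) by blast
  qed
qed

lemma affinely_generates_le_card: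
  assumes gen: "affinely_generates d B" and fin: "finite B"
  shows "d \<le> card B"
proof -
  define H where
    "H = {v \<in> int_lattice d. \<exists>T\<subseteq>B. \<forall>i. even (v i - (\<Sum>t\<in>T. t i))}"
  have diff: "u - v \<in> H" if "u \<in> H" "v \<in> H" for u v
  proof -
    obtain T U where T: "T \<subseteq> B" "\<And>i. even (u i - (\<Sum>t\<in>T. t i))"
      and U: "U \<subseteq> B" "\<And>i. even (v i - (\<Sum>t\<in>U. t i))"
      using \<open>u \<in> H\<close> \<open>v \<in> H\<close> unfolding H_def by blast
    have fT: "finite T" "finite U" using T U fin finite_subset by auto
    have "even ((u - v) i - (\<Sum>t\<in>(T - U) \<union> (U - T). t i))" for i
    proof -
      have a: "(\<Sum>t\<in>T. t i) = (\<Sum>t\<in>T - U. t i) + (\<Sum>t\<in>T \<inter> U. t i)"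
        using sum.Int_Diff[OF fT(1), of "\<lambda>t. t i" U] by simp
      have b: "(\<Sum>t\<in>U. t i) = (\<Sum>t\<in>U - T. t i) + (\<Sum>t\<in>T \<inter> U. t i)"
        using sum.Int_Diff[OF fT(2), of "\<lambda>t. t i" T] by (simp add: Int_commute)
      have c: "(\<Sum>t\<in>(T - U) \<union> (U - T). t i) = (\<Sum>t\<in>T - U. t i) + (\<Sum>t\<in>U - T. t i)"
        by (rule sum.union_disjoint) (use fT in auto)
      show ?thesis using T(2)[of i] U(2)[of i] unfolding a b c by auto
    qed
    moreover have "(T - U) \<union> (U - T) \<subseteq> B" using T U by blast
    moreover have "u - v \<in> int_lattice d" using that int_lattice_diff by (auto simp: H_def)
    ultimately show ?thesis unfolding H_def by blast
  qed
  have zero: "0 \<in> H"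
    unfolding H_def mem_Collect_eq
    by (intro conjI exI[of _ "{}"]) (simp_all add: int_lattice_def)
  have BH: "B \<subseteq> H"
  proof
    fix b assume b: "b \<in> B"
    then have "\<exists>T\<subseteq>B. \<forall>i. even (b i - (\<Sum>t\<in>T. t i))" by (intro exI[of _ "{b}"]) auto
    then show "b \<in> H" using b gen unfolding H_def affinely_generates_def by blast
  qed
  have HsubL: "H \<subseteq> int_lattice d" unfolding H_def by (rule Collect_restrict)
  have "int_affine_subspace d H"
    unfolding int_affine_subspace_def using zero diff
    by (intro exI[of _ 0] exI[of _ H] conjI ballI)
      (simp_all add: int_lattice_def HsubL[unfolded int_lattice_def])
  then have HL: "H = int_lattice d" using gen BH unfolding affinely_generates_def by blast
  have "\<exists>T\<subseteq>B. \<forall>i. even (of_bool (i \<in> I) - (\<Sum>t\<in>T. t i))" if "I \<subseteq> {..<d}" for I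
  proof -
    have "(\<lambda>i. of_bool (i \<in> I)) \<in> H" using that unfolding HL by (auto simp: int_lattice_def)
    then show ?thesis unfolding H_def by blast
  qed
  then have ex: "\<forall>I\<in>Pow {..<d}. \<exists>T. T \<subseteq> B \<and> (\<forall>i. even (of_bool (i \<in> I) - (\<Sum>t\<in>T. t i)))"
    by blast
  obtain T where T0: "\<forall>I\<in>Pow {..<d}. T I \<subseteq> B \<and> (\<forall>i. even (of_bool (i \<in> I) - (\<Sum>t\<in>T I. t i)))"
    using bchoice[OF ex] by blast
  have T: "T I \<subseteq> B" "even (of_bool (i \<in> I) - (\<Sum>t\<in>T I. t i))" if "I \<subseteq> {..<d}" for I i
    using bspec[OF T0, of I] that by simp_all
  have "inj_on T (Pow {..<d})"
  proof (rule inj_onI)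
    fix I J assume IJ: "I \<in> Pow {..<d}" "J \<in> Pow {..<d}" "T I = T J"
    have "i \<in> I \<longleftrightarrow> i \<in> J" for i
      using T(2)[of I i] T(2)[of J i] IJ by (auto split: if_splits)
    then show "I = J" by blast
  qed
  moreover have "T ` Pow {..<d} \<subseteq> Pow B" using T(1) by blast
  ultimately have "card (Pow {..<d}) \<le> card (Pow B)" using fin card_inj_on_le by blast
  then have "(2::nat) ^ d \<le> 2 ^ card B" by (simp only: card_Pow fin finite_lessThan card_lessThan)
  then show ?thesis by (rule power_le_imp_le_exp[rotated]) simp
qed

lemma finite_freiman_dims:
  assumes "finite A"
  shows "finite {d. 0 < d \<and> (\<exists>B. affinely_generates d B \<and> freiman_isomorphic A B)}"
proof (rule finite_subset)
  show "{d. 0 < d \<and> (\<exists>B. affinely_generates d B \<and> freiman_isomorphic A B)} \<subseteq> {..card A}"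
  proof
    fix d assume "d \<in> {d. 0 < d \<and> (\<exists>B. affinely_generates d B \<and> freiman_isomorphic A B)}"
    then obtain B where gen: "affinely_generates d B" and iso: "freiman_isomorphic A B"
      by blast
    obtain \<phi> \<psi> where hom: "freiman_hom A B \<phi>" "freiman_hom B A \<psi>" and inv: "\<forall>y\<in>B. \<phi> (\<psi> y) = y"
      using iso unfolding freiman_isomorphic_def freiman_iso_def by (elim exE conjE)
    have "\<psi> ` B \<subseteq> A" using hom(2) unfolding freiman_hom_def by (rule conjunct1)
    have "B \<subseteq> \<phi> ` A"
    proof
      fix y assume y: "y \<in> B"
      then have "\<psi> y \<in> A" using \<open>\<psi> ` B \<subseteq> A\<close> by (rule imageI[THEN rev_subsetD])
      then have "\<phi> (\<psi> y) \<in> \<phi> ` A" by (rule imageI)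
      then show "y \<in> \<phi> ` A" by (simp only: bspec[OF inv y])
    qed
    moreover have "finite (\<phi> ` A)" using assms by (rule finite_imageI)
    ultimately have "finite B" "card B \<le> card (\<phi> ` A)" by (rule finite_subset, rule card_mono[rotated])
    then have "d \<le> card A"
      using affinely_generates_le_card[OF gen] card_image_le[OF assms, of \<phi>] by linarith
    then show "d \<in> {..card A}" by (simp only: atMost_iff)
  qed
qed (rule finite_atMost)

end

theory Submission
  imports Defs "HOL-Analysis.L2_Norm" "HOL-Library.Z2"
begin

text \<open>
  Choose \<open>X\<close> among the nonempty subsets of \<open>A\<close> so as to maximise \<open>E(X) / |X|\<^bsup>3 - \<epsilon>\<^esup>\<close>, where \<open>\<epsilon>\<close> is a
  small multiple of \<open>1 / log K\<close>. Since \<open>E(X) \<le> |X|\<^sup>3\<close>, this costs a factor of at most \<open>K\<^bsup>1/\<epsilon>\<^esup>\<close> in size.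

  Let \<open>X\<close> be realised as an affinely generating subset of \<open>\<int>\<^sup>d\<close>, and split it into its fibres modulo 2. A set of
  large energy has a large parity fibre, because \<open>x - 2y\<close> takes few values on a dense set of pairs and
  determines the parity of \<open>x\<close>; hence almost all the energy of \<open>X\<close> comes from fibres of density at least
  \<open>K\<^bsup>-O(1)\<^esup>\<close>. By maximality no such fibre has noticeably larger normalised energy than \<open>X\<close>, so Young's
  inequality for the fibre densities on \<open>F\<^sub>2\<^sup>d\<close> is nearly an equality, and the densities are nearly
  uniform on a coset of a subgroup \<open>H\<close> with \<open>|H| \<le> K\<^bsup>O(1)\<^esup>\<close>. Discarding the few points outside the coset
  would increase the functional, so there are none. As \<open>X\<close> generates affinely, \<open>H\<close> is all of \<open>F\<^sub>2\<^sup>d\<close>, and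
  \<open>d = O(log K)\<close>.
\<close>

section \<open>Mixed energies\<close>

text \<open>The four-variable form with the additive energy on its diagonal, so that energies of
  unions can be expanded multilinearly.\<close>

definition mixed_energy :: "'a::ab_group_add set \<Rightarrow> 'a set \<Rightarrow> 'a set \<Rightarrow> 'a set \<Rightarrow> nat" where
  "mixed_energy A B C D =
     card {(a, b, c, d). a \<in> A \<and> b \<in> B \<and> c \<in> C \<and> d \<in> D \<and> a - b = c - d}"

text \<open>This is the L^4 norm of the Fourier transform of the indicator function of
  \<open>A\<close>, which is why it obeys a triangle inequality.\<close>

definition quartic_norm :: "'a::ab_group_add set \<Rightarrow> real" where
  "quartic_norm A = sqrt (sqrt (real (additive_energy A)))"

definition diff_reps :: "'a::ab_group_add set \<Rightarrow> 'a set \<Rightarrow> 'a \<Rightarrow> nat" where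
  "diff_reps A B d = card {(a, b). a \<in> A \<and> b \<in> B \<and> a - b = d}"

lemma additive_energy_eq_mixed: "additive_energy A = mixed_energy A A A A"
  by (simp add: additive_energy_def mixed_energy_def)

lemma finite_quadruples:
  assumes "finite A" "finite B" "finite C" "finite D"
  shows "finite {(a, b, c, d). a \<in> A \<and> b \<in> B \<and> c \<in> C \<and> d \<in> D \<and> P a b c d}"
  by (rule finite_subset[of _ "A \<times> B \<times> C \<times> D"]) (use assms in auto)

lemma quartic_norm_nonneg [simp]: "0 \<le> quartic_norm A"
  by (simp add: quartic_norm_def)

lemma quartic_norm_power4: "quartic_norm A ^ 4 = real (additive_energy A)"
proof -
  have "quartic_norm A ^ 4 = (quartic_norm A ^ 2) ^ 2" by simp
  then show ?thesis by (simp add: quartic_norm_def)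
qed

lemma quartic_norm_le_iff_power4:
  assumes "0 \<le> t"
  shows "quartic_norm A \<le> t \<longleftrightarrow> real (additive_energy A) \<le> t ^ 4"
  using power_mono_iff[of "quartic_norm A" t 4] assms by (simp add: quartic_norm_power4)

lemma sum_diff_reps:
  assumes "finite A" "finite B" "finite S" "(\<lambda>(a, b). a - b) ` (A \<times> B) \<subseteq> S"
  shows "(\<Sum>d\<in>S. diff_reps A B d) = card A * card B"
proof -
  have "card (A \<times> B) = (\<Sum>d\<in>S. card {p \<in> A \<times> B. (\<lambda>(a, b). a - b) p = d})"
    using sum.group[of "A \<times> B" S "\<lambda>(a, b). a - b" "\<lambda>_. 1::nat"] assms by simp
  moreover have "{p \<in> A \<times> B. (\<lambda>(a, b). a - b) p = d} = {(a, b). a \<in> A \<and> b \<in> B \<and> a - b = d}" for d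
    by auto
  ultimately show ?thesis by (simp add: diff_reps_def card_cartesian_product)
qed

lemma mixed_energy_eq_sum:
  assumes "finite A" "finite B" "finite C" "finite D" "finite S"
    "(\<lambda>(a, b). a - b) ` (A \<times> B) \<subseteq> S"
  shows "mixed_energy A B C D = (\<Sum>s\<in>S. diff_reps A B s * diff_reps C D s)"
proof -
  let ?T = "{(a, b, c, d). a \<in> A \<and> b \<in> B \<and> c \<in> C \<and> d \<in> D \<and> a - b = c - d}"
  have fin: "finite ?T" using assms(1-4) by (rule finite_quadruples)
  have "card ?T = (\<Sum>s\<in>S. card {q \<in> ?T. (\<lambda>(a, b, c, d). a - b) q = s})"
    using sum.group[of ?T S "\<lambda>(a, b, c, d). a - b" "\<lambda>_. 1::nat"] fin assms by force
  also have "\<dots> = (\<Sum>s\<in>S. diff_reps A B s * diff_reps C D s)"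
  proof (rule sum.cong[OF refl])
    fix s
    have "bij_betw (\<lambda>(a, b, c, d). ((a, b), (c, d))) {q \<in> ?T. (\<lambda>(a, b, c, d). a - b) q = s}
       ({(a, b). a \<in> A \<and> b \<in> B \<and> a - b = s} \<times> {(a, b). a \<in> C \<and> b \<in> D \<and> a - b = s})"
      by (rule bij_betw_byWitness[of _ "\<lambda>((a, b), (c, d)). (a, b, c, d)"]) auto
    then show "card {q \<in> ?T. (\<lambda>(a, b, c, d). a - b) q = s} = diff_reps A B s * diff_reps C D s"
      by (simp add: bij_betw_same_card diff_reps_def card_cartesian_product)
  qed
  finally show ?thesis by (simp add: mixed_energy_def)
qed

lemma sum_mult_squared_le:
  fixes f g :: "'a \<Rightarrow> real"
  shows "(\<Sum>i\<in>S. f i * g i)\<^sup>2 \<le> (\<Sum>i\<in>S. (f i)\<^sup>2) * (\<Sum>i\<in>S. (g i)\<^sup>2)"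
proof -
  have "\<bar>\<Sum>i\<in>S. f i * g i\<bar> \<le> L2_set f S * L2_set g S"
    using L2_set_mult_ineq[of f g S] sum_abs[of "\<lambda>i. f i * g i" S] by (simp add: abs_mult)
  then have "(\<Sum>i\<in>S. f i * g i)\<^sup>2 \<le> (L2_set f S * L2_set g S)\<^sup>2"
    by (metis abs_ge_zero power2_abs power_mono)
  then show ?thesis by (simp add: L2_set_def power_mult_distrib sum_nonneg)
qed

text \<open>Cauchy-Schwarz in the common difference \<open>s\<close>, applied to the two
  representation functions.\<close>

lemma mixed_energy_Cauchy_Schwarz:
  assumes "finite A" "finite B" "finite C" "finite D"
  shows "(real (mixed_energy A B C D))\<^sup>2 \<le> real (mixed_energy A B A B) * real (mixed_energy C D C D)"
proof -
  define S where "S = (\<lambda>(a, b). a - b) ` (A \<times> B \<union> C \<times> D)"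
  have S: "finite S" "(\<lambda>(a, b). a - b) ` (A \<times> B) \<subseteq> S" "(\<lambda>(a, b). a - b) ` (C \<times> D) \<subseteq> S"
    using assms by (auto simp: S_def)
  show ?thesis
    using sum_mult_squared_le[of "\<lambda>s. real (diff_reps A B s)" "\<lambda>s. real (diff_reps C D s)" S]
    by (simp add: mixed_energy_eq_sum[OF assms S(1,2)] power2_eq_square
        mixed_energy_eq_sum[OF assms(1,2,1,2) S(1,2)] mixed_energy_eq_sum[OF assms(3,4,3,4) S(1,3)])
qed

text \<open>Regrouping \<open>a - b = c - d\<close> as \<open>a - c = b - d\<close> separates the
  two sets, so that Cauchy-Schwarz can be applied a second time.\<close>

lemma mixed_energy_swap: "mixed_energy A B A B = mixed_energy A A B B"
proof -
  have "bij_betw (\<lambda>(a, b, c, d). (a, c, b, d))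
     {(a, b, c, d). a \<in> A \<and> b \<in> B \<and> c \<in> A \<and> d \<in> B \<and> a - b = c - d}
     {(a, b, c, d). a \<in> A \<and> b \<in> A \<and> c \<in> B \<and> d \<in> B \<and> a - b = c - d}"
    by (rule bij_betw_byWitness[of _ "\<lambda>(a, b, c, d). (a, c, b, d)"]) (auto simp: algebra_simps)
  then show ?thesis unfolding mixed_energy_def by (rule bij_betw_same_card)
qed

text \<open>Two rounds of Cauchy-Schwarz: the first separates the pair \<open>A\<close>,
  \<open>B\<close> from the pair \<open>C\<close>, \<open>D\<close>; after the swap the second
  separates the members of each pair.\<close>

lemma mixed_energy_le_quartic_norms:
  assumes "finite A" "finite B" "finite C" "finite D"
  shows "real (mixed_energy A B C D) \<le> quartic_norm A * quartic_norm B * quartic_norm C * quartic_norm D"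
proof -
  have pair: "real (mixed_energy P Q P Q) \<le> (quartic_norm P * quartic_norm Q)\<^sup>2"
    if "finite P" "finite Q" for P Q :: "'a set"
  proof (rule power2_le_imp_le)
    have "(real (mixed_energy P Q P Q))\<^sup>2 \<le> real (additive_energy P) * real (additive_energy Q)"
      using mixed_energy_Cauchy_Schwarz[of P P Q Q] that
      by (simp add: mixed_energy_swap additive_energy_eq_mixed)
    also have "\<dots> = ((quartic_norm P * quartic_norm Q)\<^sup>2)\<^sup>2"
      by (simp flip: quartic_norm_power4 add: power_mult_distrib)
    finally show "(real (mixed_energy P Q P Q))\<^sup>2 \<le> ((quartic_norm P * quartic_norm Q)\<^sup>2)\<^sup>2" .
  qed simp
  show ?thesis
  proof (rule power2_le_imp_le)
    have "(real (mixed_energy A B C D))\<^sup>2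
        \<le> (quartic_norm A * quartic_norm B)\<^sup>2 * (quartic_norm C * quartic_norm D)\<^sup>2"
      by (rule order_trans[OF mixed_energy_Cauchy_Schwarz[OF assms]])
        (intro mult_mono pair assms, simp_all)
    then show "(real (mixed_energy A B C D))\<^sup>2
        \<le> (quartic_norm A * quartic_norm B * quartic_norm C * quartic_norm D)\<^sup>2"
      by (simp add: power_mult_distrib mult.assoc)
  qed simp
qed

text \<open>Indexing by \<open>bool\<close> gives the sixteen-term expansion for a union of two
  sets. The parts may overlap, hence only an inequality.\<close>

lemma additive_energy_two_parts:
  fixes Y :: "bool \<Rightarrow> 'a::ab_group_add set"
  assumes "\<And>i. finite (Y i)"
  shows "additive_energy (\<Union>i. Y i)
    \<le> (\<Sum>i\<in>UNIV. \<Sum>j\<in>UNIV. \<Sum>k\<in>UNIV. \<Sum>l\<in>UNIV. mixed_energy (Y i) (Y j) (Y k) (Y l))"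
proof -
  define Q where "Q = (\<lambda>(i, j, k, l). {(a, b, c, d). a \<in> Y i \<and> b \<in> Y j \<and> c \<in> Y k \<and> d \<in> Y l \<and> a - b = c - d})"
  have "additive_energy (\<Union>i. Y i) \<le> card (\<Union>p\<in>UNIV \<times> UNIV \<times> UNIV \<times> UNIV. Q p)"
    unfolding additive_energy_def
  proof (rule card_mono)
    show "finite (\<Union>p\<in>UNIV \<times> UNIV \<times> UNIV \<times> UNIV. Q p)"
      using finite_quadruples[OF assms assms assms assms] by (auto simp: Q_def)
  qed (force simp: Q_def)
  also have "\<dots> \<le> (\<Sum>p\<in>UNIV \<times> UNIV \<times> UNIV \<times> UNIV. card (Q p))" by (rule card_UN_le) simp
  also have "\<dots> = (\<Sum>i\<in>UNIV. \<Sum>j\<in>UNIV. \<Sum>k\<in>UNIV. \<Sum>l\<in>UNIV. card (Q (i, j, k, l)))"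
    by (simp only: sum.cartesian_product' split_def fst_conv snd_conv)
  finally show ?thesis by (simp add: Q_def mixed_energy_def)
qed

text \<open>Each of the sixteen terms is at most a product of norms, and these products sum to the
  fourth power of the sum of the norms.\<close>

lemma quartic_norm_triangle:
  assumes "finite A" "finite B"
  shows "quartic_norm (A \<union> B) \<le> quartic_norm A + quartic_norm B"
proof -
  let ?Y = "\<lambda>i. if i then A else B"
  have fin: "finite (?Y i)" for i using assms by simp
  have U: "(\<Union>i. ?Y i) = A \<union> B" by (auto simp: UNIV_bool)
  let ?e = "\<lambda>i. quartic_norm (?Y i)"
  have "real (additive_energy (A \<union> B))
    \<le> (\<Sum>i\<in>UNIV. \<Sum>j\<in>UNIV. \<Sum>k\<in>UNIV. \<Sum>l\<in>UNIV. real (mixed_energy (?Y i) (?Y j) (?Y k) (?Y l)))"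
    using additive_energy_two_parts[of ?Y, OF fin] unfolding U of_nat_sum[symmetric] by (simp only: of_nat_le_iff)
  also have "\<dots> \<le> (\<Sum>i\<in>UNIV. \<Sum>j\<in>UNIV. \<Sum>k\<in>UNIV. \<Sum>l\<in>UNIV. ?e i * ?e j * ?e k * ?e l)"
    by (intro sum_mono mixed_energy_le_quartic_norms fin)
  also have "\<dots> = (quartic_norm A + quartic_norm B) ^ 4"
    by (simp add: UNIV_bool algebra_simps power4_eq_xxxx)
  finally show ?thesis by (simp add: quartic_norm_le_iff_power4)
qed

text \<open>An additive quadruple \<open>(a, b, c, d)\<close> is sorted by
  \<open>s = \<pi> a - \<pi> b = \<pi> c - \<pi> d\<close> and the base points
  \<open>x = \<pi> b\<close>, \<open>y = \<pi> d\<close>. Each class is a mixed energy of four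
  fibres, and for fixed \<open>s\<close> the sum over \<open>x\<close> and \<open>y\<close> factors
  into a square.\<close>

lemma additive_energy_le_fibre_norms:
  fixes \<pi> :: "'a::ab_group_add \<Rightarrow> 'b::ab_group_add"
  assumes "finite X" "finite V" "\<pi> ` X \<subseteq> V" and diffV: "\<And>u v. u \<in> V \<Longrightarrow> v \<in> V \<Longrightarrow> u - v \<in> V"
    and hom: "\<And>x y. \<pi> (x - y) = \<pi> x - \<pi> y"
  shows "real (additive_energy X) \<le>
    (\<Sum>s\<in>V. (\<Sum>x\<in>V. quartic_norm {a \<in> X. \<pi> a = x} * quartic_norm {a \<in> X. \<pi> a = x + s})\<^sup>2)"
proof -
  define F where "F x = {a \<in> X. \<pi> a = x}" for x
  have fin: "finite (F x)" for x using assms(1) by (simp add: F_def)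
  define Q where "Q = (\<lambda>(s, x, y). {(a, b, c, d).
     a \<in> F (x + s) \<and> b \<in> F x \<and> c \<in> F (y + s) \<and> d \<in> F y \<and> a - b = c - d})"
  have "additive_energy X \<le> card (\<Union>p\<in>V \<times> V \<times> V. Q p)"
    unfolding additive_energy_def
  proof (rule card_mono)
    show "finite (\<Union>p\<in>V \<times> V \<times> V. Q p)"
      using finite_quadruples[OF fin fin fin fin] assms(2) by (auto simp: Q_def)
    show "{(x, y, z, w). x \<in> X \<and> y \<in> X \<and> z \<in> X \<and> w \<in> X \<and> x - y = z - w} \<subseteq> (\<Union>p\<in>V \<times> V \<times> V. Q p)"
    proof clarify
      fix a b c d assume m: "a \<in> X" "b \<in> X" "c \<in> X" "d \<in> X" and eq: "a - b = c - d"
      have "\<pi> a - \<pi> b = \<pi> c - \<pi> d" using hom eq by metis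
      then have "(a, b, c, d) \<in> Q (\<pi> a - \<pi> b, \<pi> b, \<pi> d)"
        using m eq by (simp add: Q_def F_def algebra_simps)
      moreover have "(\<pi> a - \<pi> b, \<pi> b, \<pi> d) \<in> V \<times> V \<times> V"
        using m assms(3) by (auto intro!: diffV)
      ultimately show "(a, b, c, d) \<in> (\<Union>p\<in>V \<times> V \<times> V. Q p)" by (rule UN_I[rotated])
    qed
  qed
  also have "\<dots> \<le> (\<Sum>p\<in>V \<times> V \<times> V. card (Q p))" by (rule card_UN_le) (use assms in simp)
  also have "\<dots> = (\<Sum>s\<in>V. \<Sum>x\<in>V. \<Sum>y\<in>V. mixed_energy (F (x + s)) (F x) (F (y + s)) (F y))"
    by (simp only: sum.cartesian_product' Q_def mixed_energy_def prod.case)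
  finally have "real (additive_energy X)
    \<le> (\<Sum>s\<in>V. \<Sum>x\<in>V. \<Sum>y\<in>V. real (mixed_energy (F (x + s)) (F x) (F (y + s)) (F y)))"
    unfolding of_nat_sum[symmetric] by (simp only: of_nat_le_iff)
  also have "\<dots> \<le> (\<Sum>s\<in>V. \<Sum>x\<in>V. \<Sum>y\<in>V.
      quartic_norm (F (x + s)) * quartic_norm (F x) * quartic_norm (F (y + s)) * quartic_norm (F y))"
    by (intro sum_mono mixed_energy_le_quartic_norms fin)
  also have "\<dots> = (\<Sum>s\<in>V. (\<Sum>x\<in>V. quartic_norm (F x) * quartic_norm (F (x + s)))\<^sup>2)"
    by (simp add: power2_eq_square sum_product algebra_simps)
  finally show ?thesis by (simp add: F_def)
qed

section \<open>Large energy forces a large parity fibre\<close>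

lemma card_eq_sum_fibres:
  assumes "finite S" "finite P" "f ` S \<subseteq> P"
  shows "card S = (\<Sum>e\<in>P. card {s \<in> S. f s = e})"
  using sum.group[of S P f "\<lambda>_. 1::nat"] assms by simp

lemma card_le_fibres:
  assumes "finite S" "finite P" "f ` S \<subseteq> P" "\<And>e. e \<in> P \<Longrightarrow> real (card {s \<in> S. f s = e}) \<le> c"
  shows "real (card S) \<le> real (card P) * c"
  using sum_mono[of P "\<lambda>e. real (card {s \<in> S. f s = e})" "\<lambda>_. c"] assms
  by (simp add: card_eq_sum_fibres[OF assms(1-3)])

lemma card_ge_fibres:
  assumes "finite S" "finite P" "\<And>e. e \<in> P \<Longrightarrow> c \<le> real (card {s \<in> S. f s = e})"
  shows "real (card P) * c \<le> real (card S)"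
proof -
  have "real (card P) * c \<le> (\<Sum>e\<in>P. real (card {s \<in> {s \<in> S. f s \<in> P}. f s = e}))"
  proof -
    have "{s \<in> {s \<in> S. f s \<in> P}. f s = e} = {s \<in> S. f s = e}" if "e \<in> P" for e using that by auto
    then show ?thesis
      using sum_mono[of P "\<lambda>_. c" "\<lambda>e. real (card {s \<in> {s \<in> S. f s \<in> P}. f s = e})"] assms(3) by simp
  qed
  also have "\<dots> = real (card {s \<in> S. f s \<in> P})"
    by (subst card_eq_sum_fibres[of "{s \<in> S. f s \<in> P}" P f]) (use assms in auto)
  also have "\<dots> \<le> real (card S)" using assms(1) by (simp add: card_mono)
  finally show ?thesis .
qed

lemma diff_reps_le_card:
  assumes "finite A"
  shows "diff_reps A B d \<le> card A"
  unfolding diff_reps_def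
  by (rule card_inj_on_le[where f = fst]) (use assms in \<open>auto simp: inj_on_def algebra_simps\<close>)

text \<open>Differences with fewer than \<open>\<delta> * n / 2\<close> representations carry at
  most half of the guaranteed energy, since all representations number \<open>n^2\<close>. The rest
  of the energy is at most \<open>n\<close> times the number of pairs with popular difference; these
  pairs are the edges of a dense graph on \<open>A\<close>.\<close>

lemma popular_differences:
  fixes A :: "'a::ab_group_add set"
  assumes "finite A" "A \<noteq> {}" "0 < \<delta>" "\<delta> * real (card A) ^ 3 \<le> real (additive_energy A)"
  obtains D where "finite D" "real (card D) * \<delta> \<le> 2 * real (card A)"
    "\<delta> * real (card A) ^ 2 \<le> 2 * (\<Sum>v\<in>A. real (card {x \<in> A. v - x \<in> D}))"
proof -
  define n where "n = real (card A)"
  have n: "0 < n" using assms by (simp add: n_def card_gt_0_iff)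
  define S where "S = (\<lambda>(a, b). a - b) ` (A \<times> A)"
  have S: "finite S" "(\<lambda>(a, b). a - b) ` (A \<times> A) \<subseteq> S" using assms by (auto simp: S_def)
  define r where "r d = real (diff_reps A A d)" for d
  define D where "D = {d \<in> S. \<delta> * n / 2 \<le> r d}"
  have D: "finite D" "D \<subseteq> S" using S by (auto simp: D_def)
  have r0: "0 \<le> r d" and rn: "r d \<le> n" for d
    using diff_reps_le_card[OF assms(1)] by (auto simp: r_def n_def)
  have sumr: "(\<Sum>d\<in>S. r d) = n\<^sup>2"
    using sum_diff_reps[OF assms(1,1) S] by (simp add: r_def n_def power2_eq_square flip: of_nat_sum)
  have en: "real (additive_energy A) = (\<Sum>d\<in>S. r d * r d)"
    by (simp add: additive_energy_eq_mixed mixed_energy_eq_sum[OF assms(1,1,1,1) S] r_def)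
  have "(\<Sum>d\<in>D. \<delta> * n / 2) \<le> (\<Sum>d\<in>D. r d)" by (rule sum_mono) (simp add: D_def)
  also have "\<dots> \<le> n\<^sup>2" unfolding sumr[symmetric] by (rule sum_mono2) (use S D r0 in auto)
  finally have "(real (card D) * \<delta>) * n \<le> (2 * n) * n" by (simp add: power2_eq_square algebra_simps)
  then have cD: "real (card D) * \<delta> \<le> 2 * n" using n by (simp only: mult_le_cancel_right_pos)
  have "(\<Sum>d\<in>S. r d * r d) = (\<Sum>d\<in>D. r d * r d) + (\<Sum>d\<in>S - D. r d * r d)"
    using sum.subset_diff[OF D(2) S(1)] by (simp add: add.commute)
  also have "\<dots> \<le> (\<Sum>d\<in>D. n * r d) + (\<Sum>d\<in>S - D. (\<delta> * n / 2) * r d)"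
    by (intro add_mono sum_mono mult_right_mono) (use r0 rn in \<open>auto simp: D_def\<close>)
  also have "(\<Sum>d\<in>S - D. (\<delta> * n / 2) * r d) \<le> (\<Sum>d\<in>S. (\<delta> * n / 2) * r d)"
    by (rule sum_mono2) (use S r0 n assms in auto)
  also have "\<dots> = \<delta> * n ^ 3 / 2" unfolding sum_distrib_left[symmetric] sumr by (simp add: power_numeral_reduce)
  finally have "\<delta> * n ^ 3 \<le> 2 * n * (\<Sum>d\<in>D. r d)" using assms(4) en by (simp add: n_def flip: sum_distrib_left)
  then have "(\<delta> * n ^ 2) * n \<le> (2 * (\<Sum>d\<in>D. r d)) * n" by (simp add: power_numeral_reduce algebra_simps)
  then have *: "\<delta> * n ^ 2 \<le> 2 * (\<Sum>d\<in>D. r d)" using n by (simp only: mult_le_cancel_right_pos)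
  have "(\<Sum>d\<in>D. diff_reps A A d) = card (SIGMA v:A. {x \<in> A. v - x \<in> D})"
  proof -
    have "card (SIGMA v:A. {x \<in> A. v - x \<in> D})
      = (\<Sum>d\<in>D. card {p \<in> SIGMA v:A. {x \<in> A. v - x \<in> D}. (\<lambda>(v, x). v - x) p = d})"
      by (rule card_eq_sum_fibres) (use assms D in auto)
    moreover have "{p \<in> SIGMA v:A. {x \<in> A. v - x \<in> D}. (\<lambda>(v, x). v - x) p = d}
      = {(a, b). a \<in> A \<and> b \<in> A \<and> a - b = d}" if "d \<in> D" for d using that by auto
    ultimately show ?thesis by (simp add: diff_reps_def)
  qed
  also have "\<dots> = (\<Sum>v\<in>A. card {x \<in> A. v - x \<in> D})" by (rule card_SigmaI) (use assms in auto)
  finally have "(\<Sum>d\<in>D. r d) = (\<Sum>v\<in>A. real (card {x \<in> A. v - x \<in> D}))"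
    by (simp add: r_def flip: of_nat_sum)
  then show ?thesis using that[OF D(1)] cD * by (simp add: n_def)
qed

text \<open>Pairs with many common neighbours in the graph of popular differences have their difference in
  a set of size \<open>O(n)\<close>, because such a difference is in many ways a difference of popular differences.\<close>

lemma triples_with_controlled_differences:
  fixes A :: "'a::ab_group_add set"
  assumes "finite A" "A \<noteq> {}" "0 < \<delta>" "\<delta> * real (card A) ^ 3 \<le> real (additive_energy A)"
  obtains T D where "T \<subseteq> A \<times> A \<times> A" "finite D"
    "\<delta> ^ 3 / 16 * real (card A) ^ 3 \<le> real (card T)" "real (card D) \<le> 64 / \<delta> ^ 5 * real (card A)"
    "\<And>x y w. (x, y, w) \<in> T \<Longrightarrow> x - y \<in> D \<and> x - w \<in> D \<and> y - w \<in> D"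
proof -
  define n where "n = real (card A)"
  have n: "0 < n" using assms by (simp add: n_def card_gt_0_iff)
  obtain D where D: "finite D" "real (card D) * \<delta> \<le> 2 * n"
    "\<delta> * n ^ 2 \<le> 2 * (\<Sum>v\<in>A. real (card {x \<in> A. v - x \<in> D}))"
    using popular_differences[OF assms] unfolding n_def by blast
  define N where "N v = {x \<in> A. v - x \<in> D}" for v
  define a where "a = \<delta> * n / 2"
  \<comment> \<open>With average degree at least \<open>a\<close>, there are at least
    \<open>n * a ^ 3 = \<delta> ^ 3 * n ^ 4 / 8\<close> stars \<open>(v, x, y, w)\<close>. The value
    of \<open>\<kappa>\<close> makes the stars over bad triples at most half of this.\<close>
  define \<kappa> where "\<kappa> = \<delta> ^ 3 / 16"
  have \<kappa>: "0 < \<kappa>" and a: "0 \<le> a" using assms n by (auto simp: \<kappa>_def a_def)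
  define good where "good x y \<longleftrightarrow> \<kappa> * n \<le> real (card {v \<in> A. x \<in> N v \<and> y \<in> N v})" for x y
  define T where "T = {(x, y, w) \<in> A \<times> A \<times> A. good x y \<and> good x w \<and> good y w}"
  define D2 where "D2 = (\<lambda>(x, y). x - y) ` {(x, y) \<in> A \<times> A. good x y}"
  have finN: "finite (N v)" for v using assms by (simp add: N_def)
  have finT: "finite T" by (rule finite_subset[of _ "A \<times> A \<times> A"]) (use assms in \<open>auto simp: T_def\<close>)
  have finD2: "finite D2" unfolding D2_def
    by (rule finite_imageI, rule finite_subset[of _ "A \<times> A"]) (use assms in auto)
  define St where "St = (SIGMA v:A. N v \<times> N v \<times> N v)"
  have finSt: "finite St" using assms finN by (simp add: St_def)
  \<comment> \<open>The tangent line to the cube at \<open>a\<close>; summed over \<open>v\<close>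
    it gives the power mean bound for the degrees.\<close>
  have tangent: "3 * a\<^sup>2 * t - 2 * a ^ 3 \<le> t ^ 3" if "0 \<le> t" for t
  proof -
    have "0 \<le> (t - a)\<^sup>2 * (t + 2 * a)" using that a by simp
    also have "\<dots> = t ^ 3 - 3 * a\<^sup>2 * t + 2 * a ^ 3"
      by (simp add: power2_eq_square power3_eq_cube algebra_simps)
    finally show ?thesis by simp
  qed
  have "n * a ^ 3 \<le> 3 * a\<^sup>2 * (\<Sum>v\<in>A. real (card (N v))) - 2 * a ^ 3 * n"
  proof -
    have "n * a \<le> (\<Sum>v\<in>A. real (card (N v)))" using D(3) by (simp add: N_def a_def power2_eq_square algebra_simps)
    then have "3 * a\<^sup>2 * (n * a) \<le> 3 * a\<^sup>2 * (\<Sum>v\<in>A. real (card (N v)))" by (rule mult_left_mono) simp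
    then show ?thesis by (simp add: power2_eq_square power3_eq_cube algebra_simps)
  qed
  also have "\<dots> = (\<Sum>v\<in>A. 3 * a\<^sup>2 * real (card (N v)) - 2 * a ^ 3)"
    by (simp add: sum_subtractf sum_distrib_left n_def)
  also have "\<dots> \<le> (\<Sum>v\<in>A. real (card (N v)) ^ 3)" by (intro sum_mono tangent) simp
  also have "\<dots> = real (card St)"
    using assms finN by (simp add: St_def card_SigmaI card_cartesian_product power3_eq_cube algebra_simps)
  finally have St: "n * a ^ 3 \<le> real (card St)" .
  define f :: "'a \<times> 'a \<times> 'a \<times> 'a \<Rightarrow> 'a \<times> 'a \<times> 'a" where "f = snd"
  have bad: "real (card {s \<in> St. f s \<notin> T}) \<le> real (card (A \<times> A \<times> A)) * (\<kappa> * n)"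
  proof (rule card_le_fibres[where f = f])
    show "f ` {s \<in> St. f s \<notin> T} \<subseteq> A \<times> A \<times> A" by (auto simp: f_def St_def N_def)
    fix e assume "e \<in> A \<times> A \<times> A"
    then obtain x y w where e: "e = (x, y, w)" "x \<in> A" "y \<in> A" "w \<in> A" by auto
    show "real (card {s \<in> {s \<in> St. f s \<notin> T}. f s = e}) \<le> \<kappa> * n"
    proof (cases "e \<in> T")
      case True
      then have "{s \<in> {s \<in> St. f s \<notin> T}. f s = e} = {}" by auto
      then show ?thesis using \<kappa> n by (simp only: card.empty) simp
    next
      case False
      \<comment> \<open>A bad triple contains a pair \<open>p\<close>, \<open>q\<close> that is not
        good, and every centre \<open>v\<close> of a star over the triple is a common neighbour of
        that pair.\<close>
      have le: "card {s \<in> {s \<in> St. f s \<notin> T}. f s = e} \<le> card {v \<in> A. p \<in> N v \<and> q \<in> N v}"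
        if "{p, q} \<subseteq> {x, y, w}" for p q
        by (rule card_inj_on_le[where f = fst])
          (use that e assms in \<open>auto simp: inj_on_def f_def St_def\<close>)
      have "\<exists>p q. {p, q} \<subseteq> {x, y, w} \<and> \<not> good p q" using False e by (auto simp: T_def)
      then obtain p q where "{p, q} \<subseteq> {x, y, w}" "\<not> good p q" by blast
      then show ?thesis using le[of p q] by (simp add: good_def not_le)
    qed
  qed (use finSt assms in auto)
  have "real (card {s \<in> St. f s \<in> T}) \<le> real (card T) * n"
  proof (rule card_le_fibres[where f = f])
    fix e
    have "card {s \<in> {s \<in> St. f s \<in> T}. f s = e} \<le> card A"
      by (rule card_inj_on_le[where f = fst]) (use assms in \<open>auto simp: inj_on_def f_def St_def\<close>)
    then show "real (card {s \<in> {s \<in> St. f s \<in> T}. f s = e}) \<le> n" by (simp add: n_def)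
  qed (use finSt finT in auto)
  moreover have "card St = card {s \<in> St. f s \<in> T} + card {s \<in> St. f s \<notin> T}"
    by (subst card_Un_disjoint[symmetric]) (use finSt in \<open>auto intro: arg_cong[where f = card]\<close>)
  moreover have "real (card (A \<times> A \<times> A)) = n ^ 3" by (simp add: n_def card_cartesian_product power3_eq_cube)
  ultimately have "n * a ^ 3 \<le> real (card T) * n + n ^ 3 * (\<kappa> * n)" using St bad by simp
  then have "n * (\<delta> ^ 3 / 16 * n ^ 3) \<le> n * real (card T)"
    by (simp add: a_def \<kappa>_def power_divide power_mult_distrib algebra_simps)
  then have T: "\<delta> ^ 3 / 16 * n ^ 3 \<le> real (card T)" using n by (simp only: mult_le_cancel_left_pos)
  \<comment> \<open>A good difference \<open>x - y\<close> equals \<open>(v - y) - (v - x)\<close>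
    for at least \<open>\<kappa> * n\<close> choices of \<open>v\<close>, with both terms popular.
    The bound \<open>(2 * n / \<delta>)^2\<close> on the pairs of popular differences then gives the
    constant 64 and the exponent 5.\<close>
  have "real (card D2) * (\<kappa> * n) \<le> real (card (D \<times> D))"
  proof (rule card_ge_fibres[where f = "\<lambda>(d, d'). d' - d"])
    fix e assume "e \<in> D2"
    then obtain x y where xy: "e = x - y" "x \<in> A" "y \<in> A" "good x y" by (auto simp: D2_def)
    have "card {v \<in> A. x \<in> N v \<and> y \<in> N v} \<le> card {s \<in> D \<times> D. (\<lambda>(d, d'). d' - d) s = e}"
      by (rule card_inj_on_le[where f = "\<lambda>v. (v - x, v - y)"])
        (use xy D in \<open>auto simp: inj_on_def N_def\<close>)
    then show "\<kappa> * n \<le> real (card {s \<in> D \<times> D. (\<lambda>(d, d'). d' - d) s = e})"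
      using xy(4) by (simp add: good_def)
  qed (use D finD2 in auto)
  also have "\<dots> = (real (card D))\<^sup>2" by (simp add: card_cartesian_product power2_eq_square)
  also have "\<dots> \<le> (2 * n / \<delta>)\<^sup>2"
    by (rule power_mono) (use D assms in \<open>simp_all add: field_simps\<close>)
  finally have "real (card D2) * (\<kappa> * n) \<le> (64 / \<delta> ^ 5 * n) * (\<kappa> * n)"
    using assms(3) by (simp add: \<kappa>_def power_divide power_mult_distrib power_numeral_reduce field_simps)
  then have "real (card D2) \<le> 64 / \<delta> ^ 5 * n"
    using \<kappa> n by (subst (asm) mult_le_cancel_right_pos) auto
  then show ?thesis
    using that[of T D2] T finD2 by (auto simp: n_def T_def D2_def)
qed

text \<open>Writing \<open>x - 2y = (x - y - w) - (y - w)\<close> shows that \<open>x - 2y\<close> takes few values on the triples,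
  while each value occurs at most \<open>\<mu>\<close> times since it fixes the class of \<open>x\<close> modulo doubles.\<close>

lemma fibre_bound_of_triples:
  fixes A :: "'a::ab_group_add set" and \<pi> :: "'a \<Rightarrow> 'b"
  assumes "finite A" "A \<noteq> {}" "0 < \<tau>" "0 < L"
    and T: "T \<subseteq> A \<times> A \<times> A" "finite D" "\<tau> * real (card A) ^ 3 \<le> real (card T)"
      "real (card D) \<le> L * real (card A)"
      "\<And>x y w. (x, y, w) \<in> T \<Longrightarrow> x - y \<in> D \<and> x - w \<in> D \<and> y - w \<in> D"
    and double_inj: "\<And>x y :: 'a. x + x = y + y \<Longrightarrow> x = y"
    and double_class: "\<And>x x' y y'. x - (y + y) = x' - (y' + y') \<Longrightarrow> \<pi> x = \<pi> x'"
    and \<mu>: "\<And>c. real (card {a \<in> A. \<pi> a = c}) \<le> \<mu>"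
  shows "\<tau>\<^sup>2 * real (card A) \<le> 4 * L ^ 3 * \<mu>"
proof -
  define n where "n = real (card A)"
  have n: "0 < n" using assms(1-4) by (simp add: n_def card_gt_0_iff)
  have \<mu>0: "0 \<le> \<mu>" by (rule order_trans[OF of_nat_0_le_iff \<mu>])
  \<comment> \<open>Chosen so that the triples whose value \<open>x - y - w\<close> has few
    representations in \<open>P\<close> number at most
    \<open>L * n^2 * (\<kappa> * n) = \<tau> / 2 * n ^ 3\<close>, half of the lower bound for
    \<open>T\<close>.\<close>
  define \<kappa> where "\<kappa> = \<tau> / (2 * L)"
  have \<kappa>: "0 < \<kappa>" using assms(1-4) by (simp add: \<kappa>_def)
  have finT: "finite T" using T(1) assms(1-4) by (auto intro: finite_subset)
  define P where "P u = {p \<in> D \<times> A. (\<lambda>(d, w). d - w) p = u}" for u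
  have finP: "finite (P u)" for u using T assms(1-4) by (simp add: P_def)
  define U where "U = {u \<in> (\<lambda>(d, w). d - w) ` (D \<times> A). \<kappa> * n \<le> real (card (P u))}"
  have finU: "finite U" using T assms(1-4) by (simp add: U_def)
  have cDA: "real (card (D \<times> A)) \<le> L * n * n"
    using T(4) n by (simp add: card_cartesian_product n_def mult_right_mono)
  have "real (card U) * (\<kappa> * n) \<le> real (card (D \<times> A))"
    by (rule card_ge_fibres[where f = "\<lambda>(d, w). d - w"]) (use finU T assms(1-4) in \<open>auto simp: U_def P_def\<close>)
  also have "\<dots> \<le> (L / \<kappa> * n) * (\<kappa> * n)" using cDA \<kappa> by simp
  finally have cU: "real (card U) \<le> L / \<kappa> * n"
    using \<kappa> n by (subst (asm) mult_le_cancel_right_pos) auto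
  define g where "g = (\<lambda>(x, y, w). x - y - w :: 'a)"
  have "real (card {t \<in> T. g t \<notin> U}) \<le> real (card (D \<times> A)) * (\<kappa> * n)"
  \<comment> \<open>The key \<open>(q, y)\<close> with \<open>q = x - w\<close> already fixes the
    value \<open>q - y\<close> of \<open>g\<close>. The triples sharing a key inject into the
    representations of this value by the other splitting \<open>(x - y) - w\<close>, and an
    unpopular value has few of them.\<close>
  proof (rule card_le_fibres[where f = "\<lambda>(x, y, w). (x - w, y)"])
    show "(\<lambda>(x, y, w). (x - w, y)) ` {t \<in> T. g t \<notin> U} \<subseteq> D \<times> A" using T(1,5) by auto
    fix e assume "e \<in> D \<times> A"
    obtain q y where e: "e = (q, y)" by (cases e)
    let ?F = "{s \<in> {t \<in> T. g t \<notin> U}. (\<lambda>(x, y, w). (x - w, y)) s = e}"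
    have sub: "(\<lambda>(x, y, w). (x - y, w)) ` ?F \<subseteq> P (q - y)"
      using T(1,5) by (auto simp: P_def e)
    have "card ?F \<le> card (P (q - y))"
      by (rule card_inj_on_le[OF _ sub finP]) (auto simp: inj_on_def e)
    moreover have "real (card (P (q - y))) < \<kappa> * n" if ne: "?F \<noteq> {}"
    proof -
      obtain s where "s \<in> ?F" using ne by blast
      then obtain x w where xw: "(x, y, w) \<in> T" "g (x, y, w) \<notin> U" "x - w = q"
        by (cases s) (auto simp: e)
      have "(x - y, w) \<in> D \<times> A" using xw T(1,5) by auto
      moreover have "q - y = (\<lambda>(d, w). d - w) (x - y, w)" using xw by auto
      ultimately have "q - y \<in> (\<lambda>(d, w). d - w) ` (D \<times> A)" by blast
      moreover have "q - y \<notin> U" using xw by (auto simp: g_def algebra_simps)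
      ultimately show ?thesis by (simp add: U_def)
    qed
    ultimately show "real (card ?F) \<le> \<kappa> * n"
      using \<kappa> n by (cases "?F = {}") (simp only: card.empty, simp, linarith)
  qed (use finT T assms(1-4) in auto)
  also have "\<dots> \<le> (L * n * n) * (\<kappa> * n)" using cDA \<kappa> n by (intro mult_right_mono) auto
  also have "\<dots> = \<tau> / 2 * n ^ 3" using assms(1-4) by (simp add: \<kappa>_def power3_eq_cube)
  finally have badT: "real (card {t \<in> T. g t \<notin> U}) \<le> \<tau> / 2 * n ^ 3" .
  have "real (card {t \<in> T. g t \<in> U}) \<le> real (card (U \<times> D)) * \<mu>"
  \<comment> \<open>The key fixes \<open>x - 2y\<close>, hence the class of \<open>x\<close>,
    leaving at most \<open>\<mu>\<close> choices. Given \<open>x\<close>, halving recovers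
    \<open>y\<close>, and then \<open>y - w\<close> recovers \<open>w\<close>.\<close>
  proof (rule card_le_fibres[where f = "\<lambda>(x, y, w). (g (x, y, w), y - w)"])
    show "(\<lambda>(x, y, w). (g (x, y, w), y - w)) ` {t \<in> T. g t \<in> U} \<subseteq> U \<times> D" using T(5) by auto
    fix e
    let ?F = "{s \<in> {t \<in> T. g t \<in> U}. (\<lambda>(x, y, w). (g (x, y, w), y - w)) s = e}"
    have key: "x - (y + y) = fst e - snd e" if "(x, y, w) \<in> ?F" for x y w
      using that by (auto simp: g_def algebra_simps)
    show "real (card ?F) \<le> \<mu>"
    proof (cases "?F = {}")
      case True
      then show ?thesis using \<mu>0 by (simp only: card.empty of_nat_0)
    next
      case False
      then obtain x0 y0 w0 where 0: "(x0, y0, w0) \<in> ?F" by auto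
      have sub: "fst ` ?F \<subseteq> {a \<in> A. \<pi> a = \<pi> x0}"
      proof
        fix x assume "x \<in> fst ` ?F"
        then obtain y w where xyw: "(x, y, w) \<in> ?F" by auto
        then have "\<pi> x = \<pi> x0" using double_class[of x y x0 y0] key[OF xyw] key[OF 0] by simp
        moreover have "x \<in> A" using xyw T(1) by auto
        ultimately show "x \<in> {a \<in> A. \<pi> a = \<pi> x0}" by simp
      qed
      have inj: "inj_on fst ?F"
      proof (rule inj_onI)
        fix s t assume st: "s \<in> ?F" "t \<in> ?F" "fst s = fst t"
        obtain x y w y' w' where eq: "s = (x, y, w)" "t = (x, y', w')"
          using st(3) by (cases s, cases t) auto
        have "x - (y + y) = x - (y' + y')" using key[of x y w] key[of x y' w'] st eq by simp
        then have "x - (x - (y + y)) = x - (x - (y' + y'))" by (rule arg_cong)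
        then have "y + y = y' + y'" by (simp only: diff_diff_eq2 add_diff_cancel_left')
        then have "y = y'" by (rule double_inj)
        moreover have "y - w = y' - w'" using st eq by auto
        ultimately show "s = t" using eq by simp
      qed
      have "card ?F \<le> card {a \<in> A. \<pi> a = \<pi> x0}"
        by (rule card_inj_on_le[OF inj sub]) (use assms(1-4) in simp)
      then show ?thesis using \<mu>[of "\<pi> x0"] by linarith
    qed
  qed (use finT finU T in auto)
  also have "\<dots> \<le> (L / \<kappa> * n) * (L * n) * \<mu>"
    using cU T(4) \<mu>0 \<kappa> n assms(4)
    by (simp only: card_cartesian_product of_nat_mult, intro mult_right_mono mult_mono) (auto simp: n_def)
  also have "\<dots> = 2 * L ^ 3 / \<tau> * n\<^sup>2 * \<mu>"
    using assms(1-4) by (simp add: \<kappa>_def power_numeral_reduce)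
  finally have goodT: "real (card {t \<in> T. g t \<in> U}) \<le> 2 * L ^ 3 / \<tau> * n\<^sup>2 * \<mu>" .
  have "card T = card {t \<in> T. g t \<in> U} + card {t \<in> T. g t \<notin> U}"
    by (subst card_Un_disjoint[symmetric]) (use finT in \<open>auto intro: arg_cong[where f = card]\<close>)
  then have "\<tau> * n ^ 3 \<le> 4 * L ^ 3 / \<tau> * n\<^sup>2 * \<mu>" using badT goodT T(3) by (simp add: n_def)
  then have "n\<^sup>2 * (\<tau>\<^sup>2 * n) \<le> n\<^sup>2 * (4 * L ^ 3 * \<mu>)"
    using assms(3) by (simp add: field_simps power_numeral_reduce)
  then have "\<tau>\<^sup>2 * n \<le> 4 * L ^ 3 * \<mu>" using n by (subst (asm) mult_le_cancel_left_pos) auto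
  then show ?thesis by (simp add: n_def)
qed

text \<open>The contrapositive of the two preceding bounds combined. The normalisation is by some
  \<open>N\<close> at least \<open>card A\<close>, because the lemma is later applied to a part of a
  set and compared with the size of the whole set.\<close>

lemma energy_le_of_small_fibres:
  fixes A :: "'a::ab_group_add set" and \<pi> :: "'a \<Rightarrow> 'b"
  assumes "finite A" "0 < \<delta>" "real (card A) \<le> N"
    and double_inj: "\<And>x y :: 'a. x + x = y + y \<Longrightarrow> x = y"
    and double_class: "\<And>x x' y y'. x - (y + y) = x' - (y' + y') \<Longrightarrow> \<pi> x = \<pi> x'"
    and small: "\<And>c. 2 ^ 28 * real (card {a \<in> A. \<pi> a = c}) < \<delta> ^ 21 * N"
  shows "real (additive_energy A) \<le> \<delta> * N ^ 3"
proof (rule ccontr)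
  assume "\<not> ?thesis"
  then have E: "\<delta> * N ^ 3 < real (additive_energy A)" by simp
  have N0: "0 \<le> N" using assms(3) by linarith
  have ne: "A \<noteq> {}" using E assms(2) N0 zero_le_power[of N 3] by (auto simp: additive_energy_def mult_less_0_iff)
  define n where "n = real (card A)"
  have n: "0 < n" "n \<le> N" using assms(1-3) ne by (auto simp: n_def card_gt_0_iff)
  \<comment> \<open>The energy density relative to the true size:
    \<open>\<delta>' * n ^ 3 = \<delta> * N ^ 3\<close>.\<close>
  define \<delta>' where "\<delta>' = \<delta> * N ^ 3 / n ^ 3"
  have le: "\<delta> \<le> \<delta>'" using n assms(2) power_mono[of n N 3] by (simp add: \<delta>'_def field_simps)
  then have pos: "0 < \<delta>'" using assms(2) by simp
  obtain T D where TD: "T \<subseteq> A \<times> A \<times> A" "finite D"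
    "\<delta>' ^ 3 / 16 * real (card A) ^ 3 \<le> real (card T)" "real (card D) \<le> 64 / \<delta>' ^ 5 * real (card A)"
    "\<And>x y w. (x, y, w) \<in> T \<Longrightarrow> x - y \<in> D \<and> x - w \<in> D \<and> y - w \<in> D"
    using triples_with_controlled_differences[OF assms(1) ne pos] E n by (auto simp: \<delta>'_def n_def)
  obtain c0 where c0: "c0 \<in> \<pi> ` A" using ne by blast
  define \<mu> where "\<mu> = Max ((\<lambda>c. real (card {a \<in> A. \<pi> a = c})) ` (\<pi> ` A))"
  have fin: "finite ((\<lambda>c. real (card {a \<in> A. \<pi> a = c})) ` (\<pi> ` A))" using assms(1) by simp
  have "\<mu> \<in> (\<lambda>c. real (card {a \<in> A. \<pi> a = c})) ` (\<pi> ` A)"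
    unfolding \<mu>_def by (rule Max_in) (use fin c0 in auto)
  then have \<mu>small: "2 ^ 28 * \<mu> < \<delta> ^ 21 * N" using small by auto
  have \<mu>: "real (card {a \<in> A. \<pi> a = c}) \<le> \<mu>" for c
  proof (cases "c \<in> \<pi> ` A")
    case True
    then show ?thesis unfolding \<mu>_def by (intro Max_ge fin imageI)
  next
    case False
    then have empty: "{a \<in> A. \<pi> a = c} = {}" by auto
    have "real (card {a \<in> A. \<pi> a = c0}) \<le> \<mu>" unfolding \<mu>_def by (intro Max_ge fin imageI c0)
    then show ?thesis unfolding empty by (simp add: order_trans[OF of_nat_0_le_iff])
  qed
  have "(\<delta>' ^ 3 / 16)\<^sup>2 * n \<le> 4 * (64 / \<delta>' ^ 5) ^ 3 * \<mu>"
    unfolding n_def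
    by (rule fibre_bound_of_triples[OF assms(1) ne _ _ TD double_inj double_class \<mu>]) (use pos in auto)
  \<comment> \<open>The constants come from \<open>21 = 2 * 3 + 3 * 5\<close> and
    \<open>2 ^ 28 = 16^2 * 4 * 64 ^ 3\<close>.\<close>
  then have *: "\<delta>' ^ 21 * n \<le> 2 ^ 28 * \<mu>"
    using pos by (simp add: power_divide field_simps flip: power_mult power_add)
  \<comment> \<open>Passing from \<open>N\<close> to the smaller \<open>n\<close> is harmless: one
    factor \<open>\<delta>'\<close> already compensates for it, as
    \<open>\<delta>' * n = \<delta> * N ^ 3 / n^2\<close>.\<close>
  have "\<delta> ^ 20 * (\<delta> * N) \<le> \<delta>' ^ 20 * (\<delta>' * n)"
  proof (rule mult_mono)
    show "\<delta> ^ 20 \<le> \<delta>' ^ 20" using le assms(2) by (intro power_mono) auto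
    have "\<delta> * N * n ^ 3 \<le> \<delta> * N ^ 3 * n"
    proof -
      have "n * n \<le> N * N" using n by (intro mult_mono) auto
      then have "(\<delta> * N * n) * (n * n) \<le> (\<delta> * N * n) * (N * N)"
        using n assms(2) by (intro mult_left_mono) auto
      then show ?thesis by (simp add: power3_eq_cube algebra_simps)
    qed
    then show "\<delta> * N \<le> \<delta>' * n" using n by (simp add: \<delta>'_def field_simps)
  qed (use assms(2) pos N0 in auto)
  then have "\<delta> ^ 21 * N \<le> \<delta>' ^ 21 * n" by (simp add: power_numeral_reduce algebra_simps)
  then show False using * \<mu>small by simp
qed

section \<open>Stability in Young's inequality\<close>

lemma sum_subgroup_shift:
  fixes V :: "'b::ab_group_add set"
  assumes "0 \<in> V" "\<And>u v. u \<in> V \<Longrightarrow> v \<in> V \<Longrightarrow> u - v \<in> V" "s \<in> V"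
  shows "(\<Sum>x\<in>V. g (x + s)) = (\<Sum>x\<in>V. g x)"
proof (rule sum.reindex_bij_witness[of _ "\<lambda>x. x - s" "\<lambda>x. x + s"])
  fix x assume "x \<in> V"
  have "- s \<in> V" using assms(2)[OF assms(1,3)] by simp
  then show "x + s \<in> V" using assms(2)[OF \<open>x \<in> V\<close>, of "- s"] by simp
  show "x - s \<in> V" using assms(2)[OF \<open>x \<in> V\<close> assms(3)] .
qed simp_all

text \<open>A stability statement for Young's inequality: \<open>h s\<close> is the Hellinger distance of \<open>\<alpha>\<close> to its
  translate by \<open>s\<close>. On average it is small at differences of \<open>\<alpha>\<close>-random points, and this forces a gap
  in its values, so that the elements with small \<open>h\<close> form a subgroup.\<close>

lemma subgroup_of_translation_invariance:
  fixes V :: "'b::ab_group_add set" and \<alpha> :: "'b \<Rightarrow> real"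
  assumes V: "finite V" "0 \<in> V" "\<And>u v. u \<in> V \<Longrightarrow> v \<in> V \<Longrightarrow> u - v \<in> V"
    and \<alpha>: "\<And>x. 0 \<le> \<alpha> x" "(\<Sum>x\<in>V. \<alpha> x) \<le> 1"
    and B_def: "\<And>s. B s = (\<Sum>x\<in>V. sqrt (\<alpha> x) * sqrt (\<alpha> (x + s)))"
    and large: "1 - 1 / 50000\<^sup>2 \<le> (\<Sum>y\<in>V. \<Sum>x\<in>V. \<alpha> x * \<alpha> y * B (x - y))"
  obtains y H where "y \<in> V" "H \<subseteq> V" "0 \<in> H" "\<And>u v. u \<in> H \<Longrightarrow> v \<in> H \<Longrightarrow> u - v \<in> H"
    "1 - 1 / 20000 \<le> (\<Sum>x | x \<in> V \<and> x - y \<in> H. \<alpha> x)" "\<And>s. s \<in> H \<Longrightarrow> 1 / 2 \<le> B s"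
proof -
  define f where "f x = sqrt (\<alpha> x)" for x
  have f: "0 \<le> f x" "(f x)\<^sup>2 = \<alpha> x" for x using \<alpha>(1) by (auto simp: f_def)
  define m where "m = (\<Sum>x\<in>V. \<alpha> x)"
  have m: "0 \<le> m" "m \<le> 1" using \<alpha> by (auto simp: m_def sum_nonneg)
  define h where "h s = L2_set (\<lambda>x. f x - f (x + s)) V" for s
  have h0: "0 \<le> h s" for s by (simp add: h_def)
  have shift: "(\<Sum>x\<in>V. g (x + s)) = (\<Sum>x\<in>V. g x)" if "s \<in> V" for s and g :: "'b \<Rightarrow> real"
    using V(2,3) that by (rule sum_subgroup_shift)
  have h2: "(h s)\<^sup>2 = 2 * m - 2 * B s" if "s \<in> V" for s
  proof -
    have "(h s)\<^sup>2 = (\<Sum>x\<in>V. (f x - f (x + s))\<^sup>2)" by (simp add: h_def L2_set_def sum_nonneg)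
    also have "\<dots> = (\<Sum>x\<in>V. \<alpha> x + \<alpha> (x + s) - 2 * (f x * f (x + s)))"
      by (simp add: power2_diff f(2) algebra_simps)
    also have "\<dots> = 2 * m - 2 * B s"
      by (simp add: sum.distrib sum_subtractf shift[OF that] m_def B_def f_def flip: sum_distrib_left)
    finally show ?thesis .
  qed
  have B_le: "B s \<le> m" if "s \<in> V" for s using h2[OF that] zero_le_power2[of "h s"] by linarith
  have B_le1: "B (x - y) \<le> 1" if "x \<in> V" "y \<in> V" for x y
    using B_le[OF V(3)[OF that]] m by linarith
  \<comment> \<open>Translation by an element of \<open>V\<close> preserves the L2 norm, so the
    triangle inequality makes \<open>h\<close> subadditive.\<close>
  have h_add: "h (s + t) \<le> h s + h t" if "s \<in> V" for s t
  proof -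
    have "h (s + t) = L2_set (\<lambda>x. (f x - f (x + s)) + (f (x + s) - f (x + s + t))) V"
      by (simp add: h_def add.assoc)
    also have "\<dots> \<le> h s + L2_set (\<lambda>x. f (x + s) - f (x + s + t)) V"
      unfolding h_def by (rule L2_set_triangle_ineq)
    also have "L2_set (\<lambda>x. f (x + s) - f (x + s + t)) V = h t"
      unfolding h_def L2_set_def using shift[OF that, of "\<lambda>x. (f x - f (x + t))\<^sup>2"] by simp
    finally show ?thesis .
  qed
  have h_minus: "h (- s) = h s" if "s \<in> V" for s
    unfolding h_def L2_set_def using shift[OF that, of "\<lambda>x. (f x - f (x - s))\<^sup>2"]
    by (simp add: power2_commute)
  have h_diff: "h (s - t) \<le> h s + h t" if "s \<in> V" "t \<in> V" for s t
    using h_add[OF that(1), of "- t"] h_minus[OF that(2)] by simp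
  \<comment> \<open>The square root of the deficit allowed in \<open>large\<close>. The defect
    \<open>W\<close>, weighted by \<open>\<alpha>\<close>, sums to at most \<open>r^2\<close>, and
    the total mass exceeds 1/2, so some \<open>y\<close> has \<open>W y\<close> at most
    \<open>2 * r^2\<close>. Markov's inequality at level \<open>r\<close> then leaves mass at most
    \<open>2 * r\<close> outside \<open>R\<close>.\<close>
  define r :: real where "r = 1 / 50000"
  define W where "W y = (\<Sum>x\<in>V. \<alpha> x * (1 - B (x - y)))" for y
  have mm: "(\<Sum>y\<in>V. \<Sum>x\<in>V. \<alpha> x * \<alpha> y) = m * m"
    by (simp add: m_def sum_product mult.commute)
  have "(\<Sum>y\<in>V. \<Sum>x\<in>V. \<alpha> x * \<alpha> y * B (x - y)) \<le> (\<Sum>y\<in>V. \<Sum>x\<in>V. \<alpha> x * \<alpha> y * 1)"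
    by (intro sum_mono mult_left_mono) (use \<alpha>(1) B_le1 in auto)
  then have "1 - r\<^sup>2 \<le> m * m" using large by (simp add: mm r_def power_divide)
  moreover have "m * m \<le> m" using m by (simp add: mult_left_le)
  ultimately have m_ge: "1 - r\<^sup>2 \<le> m" by linarith
  have "(\<Sum>y\<in>V. \<alpha> y * W y) = m * m - (\<Sum>y\<in>V. \<Sum>x\<in>V. \<alpha> x * \<alpha> y * B (x - y))"
    unfolding mm[symmetric] W_def
    by (simp add: sum_distrib_left sum_subtractf[symmetric] algebra_simps)
  then have avg: "(\<Sum>y\<in>V. \<alpha> y * W y) \<le> r\<^sup>2"
    using large m mult_le_one[of m m] by (simp add: r_def power_divide)
  have "\<exists>y\<in>V. W y \<le> 2 * r\<^sup>2"
  proof (rule ccontr)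
    assume "\<not> ?thesis"
    then have "(\<Sum>y\<in>V. \<alpha> y * (2 * r\<^sup>2)) \<le> (\<Sum>y\<in>V. \<alpha> y * W y)"
      by (intro sum_mono mult_left_mono \<alpha>) auto
    then have "m * (2 * r\<^sup>2) \<le> r\<^sup>2" using avg by (simp add: m_def sum_distrib_right)
    then have "m \<le> 1 / 2" by (simp add: r_def)
    then show False using m_ge by (simp add: r_def power_divide)
  qed
  then obtain y where y: "y \<in> V" "W y \<le> 2 * r\<^sup>2" by blast
  define R where "R = {x \<in> V. 1 - B (x - y) \<le> r}"
  have "(\<Sum>x\<in>V - R. \<alpha> x * r) \<le> (\<Sum>x\<in>V - R. \<alpha> x * (1 - B (x - y)))"
    by (intro sum_mono mult_left_mono \<alpha>) (auto simp: R_def)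
  also have "\<dots> \<le> W y" unfolding W_def
    by (rule sum_mono2) (use V(1) \<alpha>(1) B_le1 y in \<open>auto intro!: mult_nonneg_nonneg\<close>)
  finally have "(\<Sum>x\<in>V - R. \<alpha> x) * r \<le> (2 * r) * r"
    using y by (simp add: sum_distrib_right power2_eq_square)
  then have mass: "(\<Sum>x\<in>V - R. \<alpha> x) \<le> 2 * r" by (simp add: r_def)
  \<comment> \<open>On \<open>R\<close> the square of \<open>h (x - y)\<close> is
    \<open>2 * m - 2 * B (x - y)\<close>, which is at most \<open>2 * r\<close>.\<close>
  define q where "q = sqrt (2 * r)"
  have q: "0 \<le> q" "q\<^sup>2 = 2 * r" by (auto simp: q_def r_def)
  have hR: "h (x - y) \<le> q" if "x \<in> R" for x
    by (rule power2_le_imp_le)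
      (use h2[of "x - y"] that V(3) y m q in \<open>auto simp: R_def\<close>)
  \<comment> \<open>No value of \<open>h\<close> lies strictly above \<open>2 * q\<close> and up to
    \<open>4 * q\<close>. If \<open>R\<close> meets its translate, \<open>s\<close> is a difference
    of two elements of \<open>R - y\<close>. Otherwise every product in \<open>B s\<close> has a
    factor outside \<open>R\<close>, so \<open>B s\<close> is too small for \<open>h s\<close> to be
    at most \<open>4 * q\<close>.\<close>
  have gap: "h s \<le> 2 * q" if s: "s \<in> V" "h s \<le> 4 * q" for s
  proof (cases "\<exists>x\<in>R. x + s \<in> R")
    case True
    then obtain x where x: "x \<in> R" "x + s \<in> R" by blast
    then have "h ((x + s - y) - (x - y)) \<le> h (x + s - y) + h (x - y)"
      using V(3) y by (intro h_diff) (auto simp: R_def)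
    then show ?thesis using hR[OF x(1)] hR[OF x(2)] by simp
  next
    case False
    have "(h s)\<^sup>2 \<le> (4 * q)\<^sup>2" using s h0 by (intro power_mono) auto
    then have "m - 16 * r \<le> B s" using h2[OF s(1)] q by (simp add: power_mult_distrib)
    have "B s \<le> (\<Sum>x\<in>V. (if x \<in> R then 0 else 5 * \<alpha> x) + (if x + s \<in> R then 0 else 5 * \<alpha> (x + s))
       + (\<alpha> x + \<alpha> (x + s)) / 20)"
      unfolding B_def f_def[symmetric]
    proof (rule sum_mono)
      fix x assume "x \<in> V"
      \<comment> \<open>Unequal weights: the large coefficient falls on the factor outside
        \<open>R\<close>, where little mass lives, and the small one on the other factor.\<close>
      have amgm: "u * v \<le> 5 * u\<^sup>2 + v\<^sup>2 / 20" for u v :: real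
      proof -
        have "0 \<le> (10 * u - v)\<^sup>2" by simp
        then show ?thesis by (simp add: power2_eq_square algebra_simps)
      qed
      show "f x * f (x + s) \<le> (if x \<in> R then 0 else 5 * \<alpha> x) + (if x + s \<in> R then 0 else 5 * \<alpha> (x + s))
       + (\<alpha> x + \<alpha> (x + s)) / 20"
        using False amgm[of "f x" "f (x + s)"] amgm[of "f (x + s)" "f x"] \<alpha>(1)[of x] \<alpha>(1)[of "x + s"]
        by (auto simp: f(2) mult.commute[of "f (x + s)"] add_divide_distrib)
    qed
    also have "\<dots> = 2 * (\<Sum>x\<in>V. if x \<in> R then 0 else 5 * \<alpha> x) + m / 10"
      using shift[OF s(1), of "\<lambda>x. if x \<in> R then 0 else 5 * \<alpha> x"] shift[OF s(1), of \<alpha>]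
      by (simp add: sum.distrib m_def flip: sum_divide_distrib)
    also have "(\<Sum>x\<in>V. if x \<in> R then 0 else 5 * \<alpha> x) = 5 * (\<Sum>x\<in>V - R. \<alpha> x)"
      unfolding sum_distrib_left using V(1) by (intro sum.mono_neutral_cong_right) auto
    finally have "B s \<le> 20 * r + m / 10" using mass by simp
    then show ?thesis using \<open>m - 16 * r \<le> B s\<close> m_ge by (simp add: r_def power_divide)
  qed
  define H where "H = {s \<in> V. h s \<le> 2 * q}"
  show ?thesis
  proof (rule that[of y H])
    have "h 0 = 0" by (simp add: h_def L2_set_def)
    then show "0 \<in> H" using V q by (simp add: H_def)
    \<comment> \<open>Subadditivity only gives \<open>4 * q\<close>; the gap brings this back down
      to \<open>2 * q\<close>.\<close>
    show "u - v \<in> H" if "u \<in> H" "v \<in> H" for u v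
      using that h_diff[of u v] gap[of "u - v"] V(3) by (auto simp: H_def)
    have "1 - 1 / 20000 \<le> m - 2 * r" using m_ge by (simp add: r_def power_divide)
    also have "\<dots> \<le> m - (\<Sum>x\<in>V - R. \<alpha> x)" using mass by simp
    also have "\<dots> = (\<Sum>x\<in>R. \<alpha> x)"
      using sum.subset_diff[of R V \<alpha>] V(1) by (auto simp: m_def R_def)
    also have "\<dots> \<le> (\<Sum>x | x \<in> V \<and> x - y \<in> H. \<alpha> x)"
    proof (rule sum_mono2)
      show "R \<subseteq> {x. x \<in> V \<and> x - y \<in> H}"
      proof
        fix x assume "x \<in> R"
        then show "x \<in> {x. x \<in> V \<and> x - y \<in> H}"
          using hR[of x] q V(3)[of x y] y by (auto simp: H_def R_def)
      qed
    qed (use V \<alpha> in auto)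
    finally show "1 - 1 / 20000 \<le> (\<Sum>x | x \<in> V \<and> x - y \<in> H. \<alpha> x)" .
    show "1 / 2 \<le> B s" if "s \<in> H" for s
    proof -
      have "(h s)\<^sup>2 \<le> (2 * q)\<^sup>2" using that h0 by (intro power_mono) (auto simp: H_def)
      then show ?thesis using h2[of s] that q m_ge
        by (auto simp: H_def power_mult_distrib r_def power_divide)
    qed
  qed (use y in \<open>auto simp: H_def\<close>)
qed

section \<open>Energy and cosets\<close>

lemma additive_energy_empty [simp]: "additive_energy {} = 0"
  unfolding additive_energy_def by (simp add: card_eq_0_iff)

lemma quartic_norm_empty [simp]: "quartic_norm {} = 0"
  by (simp add: quartic_norm_def)

lemma additive_energy_pos:
  assumes "finite A" "A \<noteq> {}"
  shows "0 < additive_energy A"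
proof -
  obtain a where "a \<in> A" using assms by blast
  then have "(a, a, a, a) \<in> {(x, y, z, w). x \<in> A \<and> y \<in> A \<and> z \<in> A \<and> w \<in> A \<and> x - y = z - w}" by simp
  then show ?thesis
    unfolding additive_energy_def card_gt_0_iff
    by (intro conjI finite_quadruples assms(1)) blast
qed

lemma quartic_norm_mono:
  assumes "finite B" "A \<subseteq> B"
  shows "quartic_norm A \<le> quartic_norm B"
proof -
  have "additive_energy A \<le> additive_energy B"
    unfolding additive_energy_def
    by (rule card_mono[OF finite_quadruples[OF assms(1,1,1,1)]]) (use assms(2) in blast)
  then show ?thesis by (simp add: quartic_norm_def)
qed

lemma mixed_energy_eq_0:
  assumes "\<And>a b c d. a \<in> A \<Longrightarrow> b \<in> B \<Longrightarrow> c \<in> C \<Longrightarrow> d \<in> D \<Longrightarrow> a - b \<noteq> c - d"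
  shows "mixed_energy A B C D = 0"
proof -
  have "{(a, b, c, d). a \<in> A \<and> b \<in> B \<and> c \<in> C \<and> d \<in> D \<and> a - b = c - d} = {}"
    using assms by blast
  then show ?thesis unfolding mixed_energy_def by (simp only: card.empty)
qed

text \<open>If three elements of an additive quadruple lie in a coset then so does the fourth, hence every
  other quadruple has at least two elements outside: \<open>11 = 6 + 4 + 1\<close>.\<close>

lemma additive_energy_coset_split:
  fixes \<pi> :: "'a::ab_group_add \<Rightarrow> 'b::ab_group_add"
  assumes "finite X"
    and H: "0 \<in> H" "\<And>u v. u \<in> H \<Longrightarrow> v \<in> H \<Longrightarrow> u - v \<in> H"
    and hom: "\<And>x y. \<pi> (x - y) = \<pi> x - \<pi> y"
    and Y0: "Y0 = {a \<in> X. \<pi> a - y \<in> H}" and Y1: "Y1 = {a \<in> X. \<pi> a - y \<notin> H}"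
  shows "real (additive_energy X)
    \<le> real (additive_energy Y0) + 11 * ((quartic_norm X)\<^sup>2 * (quartic_norm Y1)\<^sup>2)"
proof -
  define Y where "Y i = (if i then Y0 else Y1)" for i
  have fin: "finite (Y i)" for i using assms(1) by (simp add: Y_def Y0 Y1)
  have X: "(\<Union>i. Y i) = X" by (auto simp: Y_def Y0 Y1)
  define M where "M i j k l = real (mixed_energy (Y i) (Y j) (Y k) (Y l))" for i j k l
  have neg: "- u \<in> H" if "u \<in> H" for u using H(2)[OF H(1) that] by simp
  have plus: "u + v \<in> H" if "u \<in> H" "v \<in> H" for u v using H(2)[OF that(1) neg[OF that(2)]] by simp
  have rel: "(\<pi> a - y) - (\<pi> b - y) = (\<pi> c - y) - (\<pi> d - y)" if "a - b = c - d" for a b c d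
  proof -
    have "\<pi> a - \<pi> b = \<pi> c - \<pi> d" using hom that by metis
    then show ?thesis by simp
  qed
  have zero: "M False True True True = 0" "M True False True True = 0"
      "M True True False True = 0" "M True True True False = 0"
  proof -
    have 1: "\<pi> a - y \<in> H" if "a - b = c - d" "\<pi> b - y \<in> H" "\<pi> c - y \<in> H" "\<pi> d - y \<in> H" for a b c d
    proof -
      have "\<pi> a - y = ((\<pi> c - y) - (\<pi> d - y)) + (\<pi> b - y)" using rel[OF that(1)] by (simp add: algebra_simps)
      then show ?thesis using plus[OF H(2)] that by metis
    qed
    have 2: "\<pi> b - y \<in> H" if "a - b = c - d" "\<pi> a - y \<in> H" "\<pi> c - y \<in> H" "\<pi> d - y \<in> H" for a b c d
      by (rule 1[of b a d c]) (use that in \<open>auto simp: algebra_simps\<close>)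
    show "M False True True True = 0" unfolding M_def of_nat_eq_0_iff
      by (rule mixed_energy_eq_0) (use 1 in \<open>auto simp: Y_def Y0 Y1\<close>)
    show "M True False True True = 0" unfolding M_def of_nat_eq_0_iff
      by (rule mixed_energy_eq_0) (use 2 in \<open>auto simp: Y_def Y0 Y1\<close>)
    show "M True True False True = 0" unfolding M_def of_nat_eq_0_iff
      by (rule mixed_energy_eq_0) (use 1[OF sym] in \<open>auto simp: Y_def Y0 Y1\<close>)
    show "M True True True False = 0" unfolding M_def of_nat_eq_0_iff
      by (rule mixed_energy_eq_0) (use 2[OF sym] in \<open>auto simp: Y_def Y0 Y1\<close>)
  qed
  define e e0 e1 where "e = quartic_norm X" and "e0 = quartic_norm Y0" and "e1 = quartic_norm Y1"
  have e: "0 \<le> e0" "0 \<le> e1" "e0 \<le> e" "e1 \<le> e" "0 \<le> e"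
    by (auto simp: e_def e0_def e1_def Y0 Y1 intro!: quartic_norm_mono assms(1))
  define n where "n i = (if i then e0 else e1)" for i
  have M_le: "M i j k l \<le> n i * n j * n k * n l" for i j k l
    using mixed_energy_le_quartic_norms[OF fin fin fin fin, of i j k l]
    by (simp add: M_def n_def e0_def e1_def Y_def split: if_splits)
  \<comment> \<open>As \<open>e0\<close> and \<open>e1\<close> are at most \<open>e\<close>, any
    product containing \<open>e1\<close> at least twice is at most
    \<open>e^2 * e1^2\<close>.\<close>
  have c2: "e0 * e0 * e1 * e1 \<le> e * e * e1 * e1" and c3: "e0 * e1 * e1 * e1 \<le> e * e * e1 * e1"
    and c4: "e1 * e1 * e1 * e1 \<le> e * e * e1 * e1"
    using e by (auto intro!: mult_right_mono mult_mono)
  have M2: "M i j k l \<le> e\<^sup>2 * e1\<^sup>2"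
    if "\<not> i \<and> \<not> j \<or> \<not> i \<and> \<not> k \<or> \<not> i \<and> \<not> l \<or> \<not> j \<and> \<not> k \<or> \<not> j \<and> \<not> l \<or> \<not> k \<and> \<not> l" for i j k l
    using that M_le[of i j k l] c2 c3 c4
    by (cases i; cases j; cases k; cases l) (simp_all add: n_def power2_eq_square mult_ac)
  have "real (additive_energy X) \<le> (\<Sum>i\<in>UNIV. \<Sum>j\<in>UNIV. \<Sum>k\<in>UNIV. \<Sum>l\<in>UNIV. M i j k l)"
    using additive_energy_two_parts[of Y, OF fin] unfolding X M_def of_nat_sum[symmetric]
    by (simp only: of_nat_le_iff)
  also have "\<dots> \<le> M True True True True + 11 * (e\<^sup>2 * e1\<^sup>2)"
    using M2[of True True False False] M2[of True False True False] M2[of True False False True]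
      M2[of False True True False] M2[of False True False True] M2[of False False True True]
      M2[of False False False True] M2[of False False True False] M2[of False True False False]
      M2[of True False False False] M2[of False False False False]
    by (simp add: UNIV_bool zero)
  also have "M True True True True = real (additive_energy Y0)"
    by (simp add: M_def Y_def additive_energy_eq_mixed)
  finally show ?thesis by (simp add: e_def e1_def)
qed

text \<open>Maximality of \<open>E(Y) / |Y|\<close> with exponent \<open>3 - \<epsilon>\<close> on
  the size, among the subsets of \<open>X\<close>. In product form it also covers the empty
  \<open>Y\<close>, for which both sides are 0.\<close>

definition energy_extremal :: "real \<Rightarrow> 'a::ab_group_add set \<Rightarrow> bool" where
  "energy_extremal \<epsilon> X \<longleftrightarrow> (\<forall>Y\<subseteq>X. real (additive_energy Y)
     \<le> real (additive_energy X) * (real (card Y) / real (card X)) powr (3 - \<epsilon>))"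

lemma energy_extremalD:
  "energy_extremal \<epsilon> X \<Longrightarrow> Y \<subseteq> X \<Longrightarrow> real (additive_energy Y)
     \<le> real (additive_energy X) * (real (card Y) / real (card X)) powr (3 - \<epsilon>)"
  by (simp add: energy_extremal_def)

text \<open>Let \<open>\<eta>\<close> be the proportion of points off the coset. By extremality the
  points on it have energy at most \<open>E * (1 - \<eta>)\<close>, a loss linear in
  \<open>\<eta>\<close>, while the quadruples using points off it contribute only
  \<open>O(E)\<close> times a power of \<open>\<eta>\<close> above 1. For small nonzero
  \<open>\<eta>\<close> these cannot add up to \<open>E\<close>.\<close>

lemma energy_extremal_coset_rigid:
  fixes \<pi> :: "'a::ab_group_add \<Rightarrow> 'b::ab_group_add"
  assumes "finite X" "X \<noteq> {}" and ext: "energy_extremal \<epsilon> X" and "\<epsilon> \<le> 1 / 2"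
    and H: "0 \<in> H" "\<And>u v. u \<in> H \<Longrightarrow> v \<in> H \<Longrightarrow> u - v \<in> H"
    and hom: "\<And>x y. \<pi> (x - y) = \<pi> x - \<pi> y"
    and conc: "(1 - 1 / 20000) * real (card X) \<le> real (card {a \<in> X. \<pi> a - y \<in> H})"
    and a: "a \<in> X"
  shows "\<pi> a - y \<in> H"
proof (rule ccontr)
  assume nH: "\<pi> a - y \<notin> H"
  define Y0 Y1 where "Y0 = {a \<in> X. \<pi> a - y \<in> H}" and "Y1 = {a \<in> X. \<pi> a - y \<notin> H}"
  define n where "n = real (card X)"
  have n: "0 < n" using assms(1,2) by (simp add: n_def card_gt_0_iff)
  define \<eta> where "\<eta> = real (card Y1) / n"
  have "card X = card Y0 + card Y1"
    unfolding Y0_def Y1_def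
    by (subst card_Un_disjoint[symmetric]) (use assms(1) in \<open>auto intro: arg_cong[where f = card]\<close>)
  then have nsum: "n = real (card Y0) + real (card Y1)" by (simp add: n_def)
  have "0 < card Y1" using nH a assms(1) by (auto simp: Y1_def card_gt_0_iff)
  then have \<eta>0: "0 < \<eta>" using n by (simp add: \<eta>_def)
  have \<eta>1: "\<eta> \<le> 1 / 20000" using conc nsum n by (simp add: \<eta>_def Y0_def n_def field_simps)
  have Y0n: "real (card Y0) / n = 1 - \<eta>" using nsum n by (simp add: \<eta>_def field_simps)
  define E where "E = real (additive_energy X)"
  have E: "0 < E" using additive_energy_pos[OF assms(1,2)] by (simp add: E_def)
  have "real (additive_energy Y0) \<le> E * (1 - \<eta>) powr (3 - \<epsilon>)"
    using energy_extremalD[OF ext, of Y0] unfolding Y0n[symmetric] E_def n_def Y0_def by blast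
  also have "\<dots> \<le> E * (1 - \<eta>) powr 1"
    using E \<eta>0 \<eta>1 assms(4) by (intro mult_left_mono powr_mono') auto
  finally have E0: "real (additive_energy Y0) \<le> E * (1 - \<eta>)" using \<eta>1 by simp
  have "real (additive_energy Y1) \<le> E * \<eta> powr (3 - \<epsilon>)"
    using energy_extremalD[OF ext, of Y1] unfolding E_def n_def \<eta>_def Y1_def by blast
  \<comment> \<open>The bound \<open>\<epsilon> \<le> 1 / 2\<close> keeps the exponent at least 5/2;
    the square root below halves it to 5/4, still above 1.\<close>
  also have "\<dots> \<le> E * \<eta> powr (5 / 2)"
    using E \<eta>0 \<eta>1 assms(4) by (intro mult_left_mono powr_mono') auto
  finally have E1: "real (additive_energy Y1) \<le> E * \<eta> powr (5 / 2)" .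
  have "(quartic_norm X)\<^sup>2 * (quartic_norm Y1)\<^sup>2 \<le> E * \<eta> powr (5 / 4)"
  proof (rule power2_le_imp_le)
    have "((quartic_norm X)\<^sup>2 * (quartic_norm Y1)\<^sup>2)\<^sup>2 = E * real (additive_energy Y1)"
      by (simp add: power_mult_distrib E_def flip: quartic_norm_power4)
    also have "\<dots> \<le> E * (E * \<eta> powr (5 / 2))" using E1 E by simp
    also have "\<dots> = (E * \<eta> powr (5 / 4))\<^sup>2"
      by (simp add: power2_eq_square flip: powr_add)
    finally show "((quartic_norm X)\<^sup>2 * (quartic_norm Y1)\<^sup>2)\<^sup>2 \<le> (E * \<eta> powr (5 / 4))\<^sup>2" .
  qed (use E in simp)
  then have "E \<le> E * (1 - \<eta>) + 11 * (E * \<eta> powr (5 / 4))"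
    using additive_energy_coset_split[OF assms(1) H hom Y0_def Y1_def] E0 by (simp add: E_def)
  then have "E * \<eta> \<le> E * (11 * \<eta> powr (5 / 4))" by (simp add: algebra_simps)
  then have "\<eta> \<le> 11 * \<eta> powr (5 / 4)" using E by simp
  also have "\<eta> powr (5 / 4) = \<eta> * \<eta> powr (1 / 4)"
    using \<eta>0 powr_add[of \<eta> 1 "1 / 4"] by simp
  finally have "\<eta> * 1 \<le> \<eta> * (11 * \<eta> powr (1 / 4))" by simp
  then have "1 \<le> 11 * \<eta> powr (1 / 4)" using \<eta>0 by (simp only: mult_le_cancel_left_pos)
  then have "1 ^ 4 \<le> (11 * \<eta> powr (1 / 4)) ^ 4" by (intro power_mono) auto
  \<comment> \<open>\<open>11 ^ 4 = 14641\<close> is below 20000, which is what fixes the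
    concentration threshold.\<close>
  also have "\<dots> = 14641 * \<eta>"
    using \<eta>0 by (simp add: power_mult_distrib powr_powr flip: powr_realpow)
  finally show False using \<eta>1 by simp
qed

text \<open>Young's inequality with its loss recorded. Up to a constant \<open>e\<close> is at most
  the 3/4 power of \<open>\<alpha>\<close>; splitting the 3/4 power of
  \<open>\<alpha> x * \<alpha> (x + s)\<close> as a 1/2 power times a 1/4 power and applying
  Cauchy-Schwarz leaves the affinity \<open>B s\<close> as an extra factor.\<close>

lemma energy_fibre_correlation:
  fixes V :: "'b::ab_group_add set" and \<alpha> e :: "'b \<Rightarrow> real"
  assumes V: "finite V" "0 \<in> V" "\<And>u v. u \<in> V \<Longrightarrow> v \<in> V \<Longrightarrow> u - v \<in> V"
    and \<alpha>: "\<And>x. 0 \<le> \<alpha> x" and e: "\<And>x. 0 \<le> e x" "\<And>x. e x ^ 4 \<le> c * \<alpha> x ^ 3" and c: "0 \<le> c"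
    and B_def: "\<And>s. B s = (\<Sum>x\<in>V. sqrt (\<alpha> x) * sqrt (\<alpha> (x + s)))"
  shows "(\<Sum>s\<in>V. (\<Sum>x\<in>V. e x * e (x + s))\<^sup>2) \<le> c * (\<Sum>y\<in>V. \<Sum>x\<in>V. \<alpha> x * \<alpha> y * B (x - y))"
proof -
  define r where "r = sqrt (sqrt c)"
  have r: "0 \<le> r" "r ^ 4 = c"
  proof -
    have "r ^ 4 = (r\<^sup>2)\<^sup>2" by simp
    then show "r ^ 4 = c" using c by (simp add: r_def)
  qed (use c in \<open>simp add: r_def\<close>)
  define p where "p x = sqrt (sqrt (\<alpha> x))" for x
  have p: "0 \<le> p x" "(p x)\<^sup>2 = sqrt (\<alpha> x)" "p x ^ 4 = \<alpha> x" for x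
  proof -
    have "p x ^ 4 = ((p x)\<^sup>2)\<^sup>2" by simp
    then show "p x ^ 4 = \<alpha> x" using \<alpha> by (simp add: p_def)
  qed (use \<alpha> in \<open>simp_all add: p_def\<close>)
  have ep: "e x \<le> r * p x ^ 3" for x
  proof (rule power_le_imp_le_base)
    have "e x ^ Suc 3 \<le> c * \<alpha> x ^ 3" using e(2)[of x] by simp
    also have "\<dots> = (r * p x ^ 3) ^ Suc 3"
      by (simp add: power_mult_distrib r(2)[symmetric] p(3)[symmetric] flip: power_mult)
    finally show "e x ^ Suc 3 \<le> (r * p x ^ 3) ^ Suc 3" .
  qed (use r p in simp)
  have cs: "(\<Sum>x\<in>V. e x * e (x + s))\<^sup>2 \<le> c * ((\<Sum>x\<in>V. \<alpha> x * \<alpha> (x + s)) * B s)" for s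
  proof -
    have "(\<Sum>x\<in>V. e x * e (x + s)) \<le> (\<Sum>x\<in>V. (r * p x ^ 3) * (r * p (x + s) ^ 3))"
      by (intro sum_mono mult_mono ep e mult_nonneg_nonneg zero_le_power r p)
    also have "\<dots> = r\<^sup>2 * (\<Sum>x\<in>V. (p x * p (x + s))\<^sup>2 * (p x * p (x + s)))"
      by (simp add: sum_distrib_left power_numeral_reduce mult_ac)
    finally have "(\<Sum>x\<in>V. e x * e (x + s))\<^sup>2
        \<le> (r\<^sup>2 * (\<Sum>x\<in>V. (p x * p (x + s))\<^sup>2 * (p x * p (x + s))))\<^sup>2"
      by (intro power_mono sum_nonneg mult_nonneg_nonneg e)
    also have "\<dots> = c * (\<Sum>x\<in>V. (p x * p (x + s))\<^sup>2 * (p x * p (x + s)))\<^sup>2"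
      by (simp add: power_mult_distrib r(2) flip: power_mult)
    also have "\<dots> \<le> c * ((\<Sum>x\<in>V. ((p x * p (x + s))\<^sup>2)\<^sup>2) * (\<Sum>x\<in>V. (p x * p (x + s))\<^sup>2))"
      by (intro mult_left_mono sum_mult_squared_le c)
    also have "\<dots> = c * ((\<Sum>x\<in>V. \<alpha> x * \<alpha> (x + s)) * B s)"
      by (simp add: B_def power_mult_distrib p(2) \<alpha>)
    finally show ?thesis .
  qed
  have "(\<Sum>s\<in>V. (\<Sum>x\<in>V. e x * e (x + s))\<^sup>2) \<le> (\<Sum>s\<in>V. c * ((\<Sum>x\<in>V. \<alpha> x * \<alpha> (x + s)) * B s))"
    by (intro sum_mono cs)
  also have "\<dots> = c * (\<Sum>y\<in>V. \<Sum>s\<in>V. \<alpha> (s + y) * \<alpha> y * B s)"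
    by (subst sum.swap) (simp add: sum_distrib_left sum_distrib_right mult_ac add.commute)
  also have "(\<Sum>y\<in>V. \<Sum>s\<in>V. \<alpha> (s + y) * \<alpha> y * B s) = (\<Sum>y\<in>V. \<Sum>x\<in>V. \<alpha> x * \<alpha> y * B (x - y))"
  proof (rule sum.cong[OF refl])
    fix y assume "y \<in> V"
    then show "(\<Sum>s\<in>V. \<alpha> (s + y) * \<alpha> y * B s) = (\<Sum>x\<in>V. \<alpha> x * \<alpha> y * B (x - y))"
      using sum_subgroup_shift[OF V(2,3), of y "\<lambda>x. \<alpha> x * \<alpha> y * B (x - y)"] by simp
  qed
  finally show ?thesis .
qed

text \<open>The constant \<open>\<kappa>\<close> is \<open>1 / (5 * 50000\<^sup>2)\<close>, so that \<open>(1 - \<kappa>)\<^sup>5\<close> meets the hypothesis of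
  \<open>subgroup_of_translation_invariance\<close>; fibres of density below \<open>\<theta>\<close> are negligible by
  \<open>energy_le_of_small_fibres\<close>.\<close>

lemma energy_extremal_in_small_coset:
  fixes \<pi> :: "'a::ab_group_add \<Rightarrow> 'b::ab_group_add" and K \<epsilon> \<theta> :: real
  defines "\<kappa> \<equiv> 1 / 12500000000 :: real"
  assumes X: "finite X" "X \<noteq> {}" and ext: "energy_extremal \<epsilon> X" and \<epsilon>: "0 \<le> \<epsilon>" "\<epsilon> \<le> 1 / 2"
    and V: "finite V" "0 \<in> V" "\<And>u v. u \<in> V \<Longrightarrow> v \<in> V \<Longrightarrow> u - v \<in> V" "\<pi> ` X \<subseteq> V"
    and hom: "\<And>x y. \<pi> (x - y) = \<pi> x - \<pi> y" and double: "\<And>x. \<pi> (x + x) = 0"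
    and double_inj: "\<And>x y :: 'a. x + x = y + y \<Longrightarrow> x = y"
    and K: "0 < K" "real (card X) ^ 3 \<le> K * real (additive_energy X)"
    and \<theta>: "\<theta> = (\<kappa> ^ 4 / K) ^ 21 / 2 ^ 28" "1 - \<kappa> \<le> \<theta> powr \<epsilon>"
  obtains y H where "H \<subseteq> V" "0 \<in> H" "\<And>u v. u \<in> H \<Longrightarrow> v \<in> H \<Longrightarrow> u - v \<in> H"
    "\<And>a. a \<in> X \<Longrightarrow> \<pi> a - y \<in> H" "real (card H) \<le> 2 / \<theta>"
proof -
  have \<kappa>: "0 < \<kappa>" "\<kappa> < 1" by (auto simp: \<kappa>_def)
  have \<theta>0: "0 < \<theta>" unfolding \<theta>(1) using \<kappa> K(1) by simp
  define n where "n = real (card X)"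
  have n: "0 < n" using X by (simp add: n_def card_gt_0_iff)
  define E where "E = real (additive_energy X)"
  have E: "0 < E" using additive_energy_pos[OF X] by (simp add: E_def)
  define F where "F x = {a \<in> X. \<pi> a = x}" for x
  have finF: "finite (F x)" for x using X by (simp add: F_def)
  define heavy where "heavy x \<longleftrightarrow> \<theta> * n \<le> real (card (F x))" for x
  \<comment> \<open>Cutting off the light fibres ensures that
    \<open>\<alpha> x powr \<epsilon>\<close> is at least \<open>1 - \<kappa>\<close> wherever
    \<open>\<alpha> x\<close> is nonzero.\<close>
  define \<alpha> where "\<alpha> x = (if heavy x then real (card (F x)) / n else 0)" for x
  have \<alpha>0: "0 \<le> \<alpha> x" for x using n by (simp add: \<alpha>_def)
  have sumF: "(\<Sum>x\<in>W. real (card (F x))) = real (card {a \<in> X. \<pi> a \<in> W})" if "W \<subseteq> V" for W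
  proof -
    have "card {a \<in> X. \<pi> a \<in> W} = (\<Sum>x\<in>W. card {a \<in> {a \<in> X. \<pi> a \<in> W}. \<pi> a = x})"
      by (rule card_eq_sum_fibres) (use X V(1) that in \<open>auto intro: finite_subset\<close>)
    also have "\<dots> = (\<Sum>x\<in>W. card (F x))"
      by (intro sum.cong refl arg_cong[where f = card]) (auto simp: F_def)
    finally show ?thesis by (simp flip: of_nat_sum)
  qed
  have sum\<alpha>: "(\<Sum>x\<in>W. \<alpha> x) \<le> real (card {a \<in> X. \<pi> a \<in> W}) / n" if "W \<subseteq> V" for W
  proof -
    have "(\<Sum>x\<in>W. \<alpha> x) \<le> (\<Sum>x\<in>W. real (card (F x)) / n)"
      using n by (intro sum_mono) (simp add: \<alpha>_def)
    then show ?thesis using sumF[OF that] by (simp flip: sum_divide_distrib)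
  qed
  have "{a \<in> X. \<pi> a \<in> V} = X" using V(4) by auto
  then have sum1: "(\<Sum>x\<in>V. \<alpha> x) \<le> 1" using sum\<alpha>[of V] n by (simp add: n_def)
  define X1 X2 where "X1 = {a \<in> X. heavy (\<pi> a)}" and "X2 = {a \<in> X. \<not> heavy (\<pi> a)}"
  have fin12: "finite X1" "finite X2" and X12: "X = X1 \<union> X2" using X by (auto simp: X1_def X2_def)
  \<comment> \<open>The hypothesis on \<open>K\<close> turns this into
    \<open>\<kappa> ^ 4 * E\<close>, so after fourth roots the light part has relative norm at most
    \<open>\<kappa>\<close>.\<close>
  have "real (additive_energy X2) \<le> \<kappa> ^ 4 / K * n ^ 3"
  proof (rule energy_le_of_small_fibres[where \<pi> = \<pi>])
    show "real (card X2) \<le> n" unfolding n_def using X by (auto simp: X2_def intro: card_mono)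
    show "\<pi> x = \<pi> x'" if "x - (y + y) = x' - (y' + y')" for x x' y y'
    proof -
      have "\<pi> x - \<pi> (y + y) = \<pi> x' - \<pi> (y' + y')" using that hom by metis
      then show ?thesis by (simp add: double)
    qed
    fix c
    show "2 ^ 28 * real (card {a \<in> X2. \<pi> a = c}) < (\<kappa> ^ 4 / K) ^ 21 * n"
    proof (cases "heavy c")
      case True
      then have "{a \<in> X2. \<pi> a = c} = {}" by (auto simp: X2_def)
      moreover have "0 < (\<kappa> ^ 4 / K) ^ 21 * n" using \<kappa> K n by simp
      ultimately show ?thesis by (simp only: card.empty of_nat_0 mult_zero_right)
    next
      case False
      then have "{a \<in> X2. \<pi> a = c} = F c" by (auto simp: X2_def F_def)
      moreover have "real (card (F c)) < \<theta> * n" using False by (simp add: heavy_def)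
      moreover have "(\<kappa> ^ 4 / K) ^ 21 = 2 ^ 28 * \<theta>" by (simp add: \<theta>(1))
      ultimately show ?thesis by simp
    qed
    show "x = y" if "x + x = y + y" for x y :: 'a using that by (rule double_inj)
  qed (use fin12(2) \<kappa>(1) K(1) in simp_all)
  also have "\<dots> \<le> \<kappa> ^ 4 * E"
    using K \<kappa> by (simp add: n_def E_def field_simps mult_left_mono)
  also have "\<dots> = (\<kappa> * quartic_norm X) ^ 4"
    by (simp add: E_def power_mult_distrib quartic_norm_power4)
  finally have "quartic_norm X2 \<le> \<kappa> * quartic_norm X"
    using \<kappa> by (subst quartic_norm_le_iff_power4) auto
  then have "(1 - \<kappa>) * quartic_norm X \<le> quartic_norm X1"
    using quartic_norm_triangle[OF fin12] X12 by (simp add: algebra_simps)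
  then have "((1 - \<kappa>) * quartic_norm X) ^ 4 \<le> quartic_norm X1 ^ 4"
    using \<kappa> by (intro power_mono) auto
  then have X1_ge: "(1 - \<kappa>) ^ 4 * E \<le> real (additive_energy X1)"
    by (simp add: power_mult_distrib quartic_norm_power4 E_def)
  define e where "e x = quartic_norm {a \<in> X1. \<pi> a = x}" for x
  \<comment> \<open>Extremality gives the exponent \<open>3 - \<epsilon>\<close>; on heavy fibres
    the discrepancy from 3 costs only a factor \<open>1 / (1 - \<kappa>)\<close>.\<close>
  have e4: "e x ^ 4 \<le> E / (1 - \<kappa>) * \<alpha> x ^ 3" for x
  proof (cases "heavy x")
    case False
    then have "{a \<in> X1. \<pi> a = x} = {}" by (auto simp: X1_def)
    then show ?thesis using E \<alpha>0 \<kappa> by (simp only: e_def quartic_norm_empty) simp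
  next
    case True
    then have fib: "{a \<in> X1. \<pi> a = x} = F x" by (auto simp: X1_def F_def)
    have \<alpha>x: "\<alpha> x = real (card (F x)) / n" using True by (simp add: \<alpha>_def)
    have ge: "\<theta> \<le> \<alpha> x" using True n unfolding \<alpha>x by (simp add: heavy_def field_simps)
    then have pos: "0 < \<alpha> x" using \<theta>0 by simp
    have "1 - \<kappa> \<le> \<theta> powr \<epsilon>" by (rule \<theta>(2))
    also have "\<dots> \<le> \<alpha> x powr \<epsilon>" using ge \<theta>0 \<epsilon> by (intro powr_mono2) auto
    finally have le: "1 - \<kappa> \<le> \<alpha> x powr \<epsilon>" .
    have "e x ^ 4 = real (additive_energy (F x))" by (simp add: e_def fib quartic_norm_power4)
    also have "\<dots> \<le> E * \<alpha> x powr (3 - \<epsilon>)"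
      using energy_extremalD[OF ext, of "F x"] unfolding E_def \<alpha>x n_def F_def by blast
    also have "\<dots> = E * \<alpha> x ^ 3 / \<alpha> x powr \<epsilon>"
      using pos by (simp add: powr_diff)
    also have "\<dots> \<le> E * \<alpha> x ^ 3 / (1 - \<kappa>)"
      using le \<kappa> E pos by (intro divide_left_mono mult_pos_pos) auto
    finally show ?thesis by simp
  qed
  define B where "B s = (\<Sum>x\<in>V. sqrt (\<alpha> x) * sqrt (\<alpha> (x + s)))" for s
  define S where "S = (\<Sum>y\<in>V. \<Sum>x\<in>V. \<alpha> x * \<alpha> y * B (x - y))"
  have "real (additive_energy X1) \<le> (\<Sum>s\<in>V. (\<Sum>x\<in>V. e x * e (x + s))\<^sup>2)"
    unfolding e_def
    by (rule additive_energy_le_fibre_norms[OF fin12(1) V(1) _ V(3) hom]) (use V(4) in \<open>auto simp: X1_def\<close>)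
  also have "\<dots> \<le> E / (1 - \<kappa>) * S"
    unfolding S_def
    by (rule energy_fibre_correlation[OF V(1-3) \<alpha>0 _ e4 _ B_def]) (use E \<kappa> in \<open>auto simp: e_def\<close>)
  \<comment> \<open>Four factors \<open>1 - \<kappa>\<close> are lost in passing to the heavy part
    and one in replacing the exponent \<open>3 - \<epsilon>\<close> by 3; Bernoulli's inequality
    linearises the fifth power.\<close>
  finally have "E * (1 - \<kappa>) ^ 4 \<le> E * (S / (1 - \<kappa>))" using X1_ge by (simp add: mult.commute)
  then have "(1 - \<kappa>) ^ 4 \<le> S / (1 - \<kappa>)" using E by (simp only: mult_le_cancel_left_pos)
  then have "(1 - \<kappa>) ^ 4 * (1 - \<kappa>) \<le> S" using \<kappa> by (simp add: pos_le_divide_eq)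
  then have "(1 - \<kappa>) ^ 5 \<le> S" by (simp add: power_numeral_reduce mult_ac)
  moreover have "1 - 5 * \<kappa> \<le> (1 - \<kappa>) ^ 5"
    using Bernoulli_inequality[of "- \<kappa>" 5] \<kappa> by simp
  ultimately have S: "1 - 1 / 50000\<^sup>2 \<le> S" by (simp add: \<kappa>_def)
  obtain y H where H: "y \<in> V" "H \<subseteq> V" "0 \<in> H" "\<And>u v. u \<in> H \<Longrightarrow> v \<in> H \<Longrightarrow> u - v \<in> H"
    "1 - 1 / 20000 \<le> (\<Sum>x | x \<in> V \<and> x - y \<in> H. \<alpha> x)" "\<And>s. s \<in> H \<Longrightarrow> 1 / 2 \<le> B s"
    using subgroup_of_translation_invariance[OF V(1-3) \<alpha>0 sum1 B_def S[unfolded S_def]] by blast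
  have conc: "(1 - 1 / 20000) * real (card X) \<le> real (card {a \<in> X. \<pi> a - y \<in> H})"
  proof -
    have "1 - 1 / 20000 \<le> real (card {a \<in> X. \<pi> a \<in> {x. x \<in> V \<and> x - y \<in> H}}) / n"
      by (rule order_trans[OF H(5) sum\<alpha>]) auto
    moreover have "{a \<in> X. \<pi> a \<in> {x. x \<in> V \<and> x - y \<in> H}} = {a \<in> X. \<pi> a - y \<in> H}" using V(4) by auto
    ultimately show ?thesis using n by (simp add: n_def field_simps)
  qed
  have coset: "\<pi> a - y \<in> H" if "a \<in> X" for a
    by (rule energy_extremal_coset_rigid[OF X ext \<epsilon>(2) H(3,4) hom conc that])
  \<comment> \<open>The sum of \<open>B\<close> over \<open>V\<close> is the square of the sum of
    \<open>sqrt (\<alpha> x)\<close>. Cauchy-Schwarz bounds that by the number of heavy fibres,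
    which is at most \<open>1 / \<theta>\<close> because the total mass is at most 1.\<close>
  have "real (card H) * (1 / 2) = (\<Sum>s\<in>H. 1 / 2)" by simp
  also have "\<dots> \<le> (\<Sum>s\<in>H. B s)" by (rule sum_mono) (rule H(6))
  also have "\<dots> \<le> (\<Sum>s\<in>V. B s)"
    by (rule sum_mono2[OF V(1) H(2)]) (auto simp: B_def \<alpha>0 intro!: sum_nonneg)
  also have "\<dots> = (\<Sum>x\<in>V. sqrt (\<alpha> x) * (\<Sum>s\<in>V. sqrt (\<alpha> (s + x))))"
    unfolding B_def by (subst sum.swap) (simp add: sum_distrib_left add.commute)
  also have "\<dots> = (\<Sum>x\<in>V. sqrt (\<alpha> x) * (\<Sum>s\<in>V. sqrt (\<alpha> s)))"
    by (intro sum.cong refl arg_cong2[where f = "(*)"] sum_subgroup_shift[OF V(2,3)])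
  also have "\<dots> = (\<Sum>x\<in>V. of_bool (heavy x) * sqrt (\<alpha> x))\<^sup>2"
  proof -
    have "of_bool (heavy x) * sqrt (\<alpha> x) = sqrt (\<alpha> x)" for x by (simp add: \<alpha>_def)
    then show ?thesis by (simp only: power2_eq_square sum_distrib_right)
  qed
  also have "\<dots> \<le> (\<Sum>x\<in>V. (of_bool (heavy x))\<^sup>2) * (\<Sum>x\<in>V. (sqrt (\<alpha> x))\<^sup>2)"
    by (rule sum_mult_squared_le)
  also have "\<dots> \<le> (1 / \<theta>) * 1"
  proof (rule mult_mono)
    have "\<theta> * of_bool (heavy x) \<le> \<alpha> x" for x
      using n by (simp add: \<alpha>_def heavy_def field_simps)
    then have "(\<Sum>x\<in>V. \<theta> * of_bool (heavy x)) \<le> 1"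
      by (intro order_trans[OF sum_mono sum1])
    then show "(\<Sum>x\<in>V. (of_bool (heavy x))\<^sup>2) \<le> 1 / \<theta>"
      using \<theta>0 by (simp only: power2_eq_square of_bool_conj[symmetric] conj_absorb)
        (simp only: pos_le_divide_eq mult.commute[of _ \<theta>] sum_distrib_left)
  qed (use \<theta>0 sum1 \<alpha>0 in \<open>auto intro!: sum_nonneg\<close>)
  finally have "real (card H) \<le> 2 / \<theta>" by simp
  then show ?thesis using that H coset by blast
qed

section \<open>The lattice and its reduction modulo 2\<close>

definition parity :: "(nat \<Rightarrow> int) \<Rightarrow> nat \<Rightarrow> bit" where
  "parity v = (\<lambda>i. of_int (v i))"

definition bit_space :: "nat \<Rightarrow> (nat \<Rightarrow> bit) set" where
  "bit_space d = {s. \<forall>i\<ge>d. s i = 0}"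

lemma bij_betw_bit_space: "bij_betw (\<lambda>s. {i. s i = 1}) (bit_space d) (Pow {..<d})"
proof (rule bij_betw_byWitness[where f' = "\<lambda>I i. of_bool (i \<in> I)"])
  show "\<forall>s\<in>bit_space d. (\<lambda>i. of_bool (i \<in> {i. s i = 1})) = s"
  proof (intro ballI ext)
    fix s :: "nat \<Rightarrow> bit" and i
    show "of_bool (i \<in> {i. s i = 1}) = s i" by (cases "s i = 1") auto
  qed
  show "(\<lambda>s. {i. s i = 1}) ` bit_space d \<subseteq> Pow {..<d}"
  proof (intro image_subsetI PowI subsetI)
    fix s :: "nat \<Rightarrow> bit" and i assume s: "s \<in> bit_space d" "i \<in> {i. s i = 1}"
    have "\<not> d \<le> i"
    proof
      assume "d \<le> i"
      then have "s i = 0" using s(1) unfolding bit_space_def by blast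
      moreover have "s i = 1" using s(2) by blast
      ultimately show False by simp
    qed
    then show "i \<in> {..<d}" by simp
  qed
qed (auto simp: bit_space_def)

lemma finite_bit_space: "finite (bit_space d)"
  using bij_betw_finite[OF bij_betw_bit_space] by simp

lemma card_bit_space: "card (bit_space d) = 2 ^ d"
  using bij_betw_same_card[OF bij_betw_bit_space] by (simp add: card_Pow)

lemma parity_diff: "parity (u - v) = parity u - parity v"
  by (rule ext) (simp add: parity_def)

lemma parity_double: "parity (v + v) = 0"
  by (rule ext) (simp add: parity_def)

lemma parity_in_bit_space: "v \<in> int_lattice d \<Longrightarrow> parity v \<in> bit_space d"
  by (simp add: int_lattice_def bit_space_def parity_def)

lemma parity_surj:
  assumes "s \<in> bit_space d"
  obtains v where "v \<in> int_lattice d" "parity v = s"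
proof (rule that[of "\<lambda>i. of_bool (s i = 1)"])
  show "parity (\<lambda>i. of_bool (s i = 1)) = s"
  proof
    fix i show "parity (\<lambda>i. of_bool (s i = 1)) i = s i" by (cases "s i = 1") (auto simp: parity_def)
  qed
qed (use assms in \<open>auto simp: int_lattice_def bit_space_def\<close>)

text \<open>The lattice points whose parity lies in the coset form an affine subspace containing
  \<open>X\<close>, so they are the whole lattice, and parity maps the lattice onto
  \<open>bit_space d\<close>.\<close>

lemma affinely_generates_parity_coset:
  assumes gen: "affinely_generates d X" and "X \<noteq> {}"
    and H: "0 \<in> H" "\<And>u v. u \<in> H \<Longrightarrow> v \<in> H \<Longrightarrow> u - v \<in> H"
    and coset: "\<And>a. a \<in> X \<Longrightarrow> parity a - y \<in> H"
  shows "bit_space d \<subseteq> H"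
proof
  fix s assume s: "s \<in> bit_space d"
  define S where "S = {v \<in> int_lattice d. parity v - y \<in> H}"
  have XL: "X \<subseteq> int_lattice d" using gen by (simp add: affinely_generates_def)
  obtain a where a: "a \<in> X" "a \<in> int_lattice d" using assms(2) XL by blast
  have zeroL: "0 \<in> int_lattice d" by (simp add: int_lattice_def)
  have zeroP: "parity 0 = 0" by (rule ext) (simp add: parity_def)
  have "int_affine_subspace d S"
    unfolding int_affine_subspace_def
  proof (intro exI[of _ a] exI[of _ "{h \<in> int_lattice d. parity h \<in> H}"] conjI ballI)
    show "a \<in> int_lattice d" by fact
    show "0 \<in> {h \<in> int_lattice d. parity h \<in> H}" using zeroL H(1) zeroP by simp
    show "u - v \<in> {h \<in> int_lattice d. parity h \<in> H}"
      if "u \<in> {h \<in> int_lattice d. parity h \<in> H}" "v \<in> {h \<in> int_lattice d. parity h \<in> H}" for u v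
      using that H(2) int_lattice_diff by (simp add: parity_diff)
    show "S = (\<lambda>h. a + h) ` {h \<in> int_lattice d. parity h \<in> H}"
    proof (intro equalityI subsetI)
      fix v assume v: "v \<in> S"
      have "parity (v - a) = (parity v - y) - (parity a - y)" by (simp add: parity_diff)
      then have "parity (v - a) \<in> H" using H(2)[of "parity v - y" "parity a - y"] v coset[OF a(1)] by (simp add: S_def)
      moreover have "v - a \<in> int_lattice d" using v a int_lattice_diff by (simp add: S_def)
      ultimately show "v \<in> (\<lambda>h. a + h) ` {h \<in> int_lattice d. parity h \<in> H}"
        by (intro image_eqI[of _ _ "v - a"]) auto
    next
      fix v assume "v \<in> (\<lambda>h. a + h) ` {h \<in> int_lattice d. parity h \<in> H}"
      then obtain h where h: "v = a + h" "h \<in> int_lattice d" "parity h \<in> H" by blast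
      have "0 - parity h \<in> H" using H h by blast
      then have "(parity a - y) - (0 - parity h) \<in> H" using H(2) coset[OF a(1)] by blast
      moreover have "parity v = parity a + parity h"
        using parity_diff[of v h] h(1) by (simp add: algebra_simps)
      ultimately show "v \<in> S" using h a int_lattice_add by (simp add: S_def algebra_simps)
    qed
  qed blast
  moreover have "X \<subseteq> S" using XL coset by (auto simp: S_def)
  ultimately have S: "S = int_lattice d" using gen unfolding affinely_generates_def by blast
  obtain v where v: "v \<in> int_lattice d" "parity v = s" using parity_surj[OF s] .
  \<comment> \<open>The second membership comes from the lattice point 0; subtracting removes the
    unknown translate \<open>y\<close>.\<close>
  have "s - y \<in> H" "0 - y \<in> H" using S v zeroL zeroP unfolding S_def by force+
  then show "s \<in> H" using H(2)[of "s - y" "0 - y"] by simp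
qed

section \<open>Invariance under Freiman isomorphisms\<close>

lemma additive_energy_image:
  assumes "inj_on f Y"
    and "\<And>x y z w. x \<in> Y \<Longrightarrow> y \<in> Y \<Longrightarrow> z \<in> Y \<Longrightarrow> w \<in> Y \<Longrightarrow> x - y = z - w \<longleftrightarrow> f x - f y = f z - f w"
  shows "additive_energy (f ` Y) = additive_energy Y"
proof -
  let ?Q = "{(x, y, z, w). x \<in> Y \<and> y \<in> Y \<and> z \<in> Y \<and> w \<in> Y \<and> x - y = z - w}"
  let ?g = "\<lambda>(x, y, z, w). (f x, f y, f z, f w)"
  have "inj_on ?g ?Q" using assms(1) by (auto simp: inj_on_def)
  moreover have "?g ` ?Q = {(x, y, z, w). x \<in> f ` Y \<and> y \<in> f ` Y \<and> z \<in> f ` Y \<and> w \<in> f ` Y \<and> x - y = z - w}"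
  proof (intro equalityI subsetI)
    fix q assume "q \<in> ?g ` ?Q"
    then obtain x y z w where q: "q = (f x, f y, f z, f w)" "x \<in> Y" "y \<in> Y" "z \<in> Y" "w \<in> Y" "x - y = z - w"
      by auto
    then show "q \<in> {(x, y, z, w). x \<in> f ` Y \<and> y \<in> f ` Y \<and> z \<in> f ` Y \<and> w \<in> f ` Y \<and> x - y = z - w}"
      using assms(2)[of x y z w] by simp
  next
    fix q assume "q \<in> {(x, y, z, w). x \<in> f ` Y \<and> y \<in> f ` Y \<and> z \<in> f ` Y \<and> w \<in> f ` Y \<and> x - y = z - w}"
    then obtain x y z w where q: "q = ?g (x, y, z, w)" "x \<in> Y" "y \<in> Y" "z \<in> Y" "w \<in> Y" "f x - f y = f z - f w"
      by auto
    then have "(x, y, z, w) \<in> ?Q" using assms(2)[of x y z w] by simp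
    then show "q \<in> ?g ` ?Q" using q(1) by blast
  qed
  ultimately show ?thesis unfolding additive_energy_def using card_image[of ?g ?Q] by simp
qed

lemma freiman_isomorphic_inverse:
  assumes "freiman_isomorphic A B"
  obtains \<psi> where "\<psi> ` B = A" "inj_on \<psi> B"
    "\<And>x y z w. x \<in> B \<Longrightarrow> y \<in> B \<Longrightarrow> z \<in> B \<Longrightarrow> w \<in> B \<Longrightarrow> x - y = z - w \<longleftrightarrow> \<psi> x - \<psi> y = \<psi> z - \<psi> w"
proof -
  obtain \<phi> \<psi> where hom: "freiman_hom A B \<phi>" "freiman_hom B A \<psi>"
    and inv: "\<forall>x\<in>A. \<psi> (\<phi> x) = x" "\<forall>y\<in>B. \<phi> (\<psi> y) = y"
    using assms unfolding freiman_isomorphic_def freiman_iso_def by blast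
  have img: "\<psi> ` B = A"
  proof
    show "\<psi> ` B \<subseteq> A" using hom(2) by (simp add: freiman_hom_def)
    show "A \<subseteq> \<psi> ` B"
    proof
      fix x assume x: "x \<in> A"
      then have "\<phi> x \<in> B" using hom(1) by (auto simp: freiman_hom_def)
      then show "x \<in> \<psi> ` B" using inv(1) x by (intro image_eqI[of _ _ "\<phi> x"]) auto
    qed
  qed
  have diff_iff: "(x - y = z - w) = (x + w = y + z)" for x y z w :: "'c::ab_group_add"
    by (auto simp: algebra_simps)
  have "x - y = z - w \<longleftrightarrow> \<psi> x - \<psi> y = \<psi> z - \<psi> w" if m: "x \<in> B" "y \<in> B" "z \<in> B" "w \<in> B" for x y z w
  proof
    assume "x - y = z - w"
    then show "\<psi> x - \<psi> y = \<psi> z - \<psi> w"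
      unfolding diff_iff using hom(2) m unfolding freiman_hom_def by blast
  next
    assume "\<psi> x - \<psi> y = \<psi> z - \<psi> w"
    moreover have "\<psi> x \<in> A" "\<psi> y \<in> A" "\<psi> z \<in> A" "\<psi> w \<in> A" using m img by auto
    ultimately have "\<phi> (\<psi> x) + \<phi> (\<psi> w) = \<phi> (\<psi> y) + \<phi> (\<psi> z)"
      unfolding diff_iff using hom(1) unfolding freiman_hom_def by blast
    then show "x - y = z - w" unfolding diff_iff using inv(2) m by simp
  qed
  moreover have "inj_on \<psi> B" using inv(2) by (metis inj_onI)
  ultimately show ?thesis using that img by blast
qed

text \<open>Extremality depends only on the sizes and additive quadruples of subsets, so it passes
  from a set of integers to its lattice models.\<close>

lemma energy_extremal_freiman_isomorphic:
  assumes iso: "freiman_isomorphic A B" and ext: "energy_extremal \<epsilon> A"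
  shows "energy_extremal \<epsilon> B" "card B = card A" "additive_energy B = additive_energy A"
proof -
  obtain \<psi> where \<psi>: "\<psi> ` B = A" "inj_on \<psi> B"
    "\<And>x y z w. x \<in> B \<Longrightarrow> y \<in> B \<Longrightarrow> z \<in> B \<Longrightarrow> w \<in> B \<Longrightarrow> x - y = z - w \<longleftrightarrow> \<psi> x - \<psi> y = \<psi> z - \<psi> w"
    using freiman_isomorphic_inverse[OF iso] by blast
  have inj: "inj_on \<psi> Y" if "Y \<subseteq> B" for Y using \<psi>(2) that by (rule inj_on_subset)
  have c: "card (\<psi> ` Y) = card Y" if "Y \<subseteq> B" for Y using inj[OF that] by (rule card_image)
  have e: "additive_energy (\<psi> ` Y) = additive_energy Y" if "Y \<subseteq> B" for Y
    by (rule additive_energy_image[OF inj[OF that]]) (rule \<psi>(3); use that in blast)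
  show "card B = card A" "additive_energy B = additive_energy A" using c[of B] e[of B] \<psi>(1) by auto
  show "energy_extremal \<epsilon> B"
    unfolding energy_extremal_def
  proof (intro allI impI)
    fix Y assume Y: "Y \<subseteq> B"
    then have "\<psi> ` Y \<subseteq> A" using \<psi>(1) by blast
    from energy_extremalD[OF ext this]
    show "real (additive_energy Y) \<le> real (additive_energy B) * (real (card Y) / real (card B)) powr (3 - \<epsilon>)"
      using c[OF Y] e[OF Y] c[of B] e[of B] \<psi>(1) by simp
  qed
qed

section \<open>Choice of the extremal subset\<close>

lemma additive_energy_le_cube:
  assumes "finite A"
  shows "additive_energy A \<le> card A ^ 3"
proof -
  have "additive_energy A \<le> card (A \<times> A \<times> A)"
    unfolding additive_energy_def
    by (rule card_inj_on_le[where f = "\<lambda>(x, y, z, w). (x, y, z)"])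
      (use assms in \<open>auto simp: inj_on_def\<close>)
  then show ?thesis by (simp add: card_cartesian_product power3_eq_cube)
qed

text \<open>Take a maximiser \<open>X\<close> of \<open>q\<close> and compare it with
  \<open>A\<close> itself: \<open>x ^ 3 * (a / x) powr \<epsilon>\<close> is at most
  \<open>K\<close> times the energy of \<open>X\<close>. Since \<open>a / x\<close> is at least 1,
  the energy density is not lost; since the energy of \<open>X\<close> is at most
  \<open>x ^ 3\<close>, the ratio \<open>a / x\<close> is bounded.\<close>

lemma energy_extremal_subset_exists:
  fixes A :: "'a::ab_group_add set"
  assumes A: "finite A" "A \<noteq> {}" and K: "0 < K" "real (card A) ^ 3 \<le> K * real (additive_energy A)"
    and \<epsilon>: "0 < \<epsilon>"
  obtains X where "X \<subseteq> A" "X \<noteq> {}" "energy_extremal \<epsilon> X"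
    "real (card X) ^ 3 \<le> K * real (additive_energy X)" "real (card A) / real (card X) \<le> K powr (1 / \<epsilon>)"
proof -
  define q where "q Y = real (additive_energy Y) / real (card Y) powr (3 - \<epsilon>)" for Y :: "'a set"
  have fin: "finite (q ` (Pow A - {{}}))" using A by simp
  have ne: "q ` (Pow A - {{}}) \<noteq> {}" using A by auto
  from Max_in[OF fin ne] obtain X where X: "X \<subseteq> A" "X \<noteq> {}" "q X = Max (q ` (Pow A - {{}}))"
    unfolding image_iff by (metis DiffE PowD singletonI)
  have max: "q Y \<le> q X" if "Y \<subseteq> A" "Y \<noteq> {}" for Y
    unfolding X(3) using fin that by (intro Max_ge) auto
  have finX: "finite X" using X A finite_subset by blast
  have cX: "0 < real (card X)" using X finX by (simp add: card_gt_0_iff)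
  have bound: "real (additive_energy Y) \<le> real (additive_energy X) * (real (card Y) / real (card X)) powr (3 - \<epsilon>)"
    if "Y \<subseteq> A" for Y
  proof (cases "Y = {}")
    case False
    then have "0 < real (card Y)" using that A finite_subset by (auto simp: card_gt_0_iff)
    then show ?thesis using max[OF that False] cX by (simp add: q_def powr_divide field_simps)
  qed simp
  have ext: "energy_extremal \<epsilon> X" unfolding energy_extremal_def using bound X(1) by blast
  define a x where "a = real (card A)" and "x = real (card X)"
  have ax: "0 < x" "x \<le> a" using cX X(1) A by (auto simp: a_def x_def card_mono)
  have "a ^ 3 \<le> K * (real (additive_energy X) * (a / x) powr (3 - \<epsilon>))"
    using order_trans[OF K(2) mult_left_mono[OF bound[OF order_refl] less_imp_le[OF K(1)]]]
    by (simp only: a_def x_def)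
  also have "\<dots> = K * real (additive_energy X) * (a ^ 3 / x ^ 3 / (a / x) powr \<epsilon>)"
    using ax by (simp add: powr_diff power_divide)
  finally have 2: "x ^ 3 * (a / x) powr \<epsilon> \<le> K * real (additive_energy X)"
    using ax by (simp add: field_simps)
  have "1 \<le> (a / x) powr \<epsilon>" using ax \<epsilon> by (intro ge_one_powr_ge_zero) auto
  then have "x ^ 3 * 1 \<le> x ^ 3 * (a / x) powr \<epsilon>" using ax by (intro mult_left_mono) auto
  then have 1: "x ^ 3 \<le> K * real (additive_energy X)" using 2 by linarith
  have "real (additive_energy X) \<le> x ^ 3"
    using additive_energy_le_cube[OF finX] by (simp add: x_def flip: of_nat_power)
  then have "K * real (additive_energy X) \<le> K * x ^ 3" using K(1) by (intro mult_left_mono) auto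
  then have "x ^ 3 * (a / x) powr \<epsilon> \<le> x ^ 3 * K" using 2 by (simp add: mult.commute)
  then have "(a / x) powr \<epsilon> \<le> K" using ax by simp
  then have "((a / x) powr \<epsilon>) powr (1 / \<epsilon>) \<le> K powr (1 / \<epsilon>)" using \<epsilon> by (intro powr_mono2) auto
  then have "a / x \<le> K powr (1 / \<epsilon>)" using \<epsilon> ax by (simp add: powr_powr)
  then show ?thesis using that[OF X(1,2) ext] 1 by (simp add: a_def x_def)
qed

lemma freiman_dim_le:
  assumes "\<And>d B. affinely_generates d B \<Longrightarrow> freiman_isomorphic A B \<Longrightarrow> real d \<le> D" "0 \<le> D" "finite A"
  shows "real (freiman_dim A) \<le> D"
proof (cases "{d. 0 < d \<and> (\<exists>B. affinely_generates d B \<and> freiman_isomorphic A B)} = {}")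
  \<comment> \<open>With no admissible positive dimension, as for a singleton, the supremum of the
    empty set of naturals is 0.\<close>
  case True
  then show ?thesis using assms(2) unfolding freiman_dim_def True by (simp add: Sup_nat_def)
next
  case False
  then have "freiman_dim A \<in> {d. 0 < d \<and> (\<exists>B. affinely_generates d B \<and> freiman_isomorphic A B)}"
    unfolding freiman_dim_def Sup_nat_def using Max_in[OF finite_freiman_dims[OF assms(3)] False] by presburger
  then show ?thesis using assms(1) by blast
qed

theorem theorem1p5:
  shows "\<exists>C C' :: real. C > 0 \<and> C' > 0 \<and>
    (\<forall>(K :: real) (A :: int set).
       K \<ge> 2 \<longrightarrow> finite A \<longrightarrow> A \<noteq> {} \<longrightarrow>
       real (additive_energy A) \<ge> real (card A) ^ 3 / K \<longrightarrow>
       (\<exists>X. X \<subseteq> A \<and> X \<noteq> {} \<and>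
            real (freiman_dim X) \<le> C * ln K \<and>
            real (card A) / real (card X) \<le> C' * exp (C * (ln K)\<^sup>2)))"
proof -
  define \<kappa> :: real where "\<kappa> = 1 / 12500000000"
  \<comment> \<open>\<open>2905 = 28 + 21 + 84 * 34\<close> collects the coefficients of
    \<open>L\<close> below, and the division by \<open>\<kappa>\<close> comes from the exponent
    \<open>1 / \<epsilon> = L / \<kappa>\<close>.\<close>
  define C where "C = 2905 / \<kappa>"
  have \<kappa>: "0 < \<kappa>" "\<kappa> \<le> 1 / 2" by (auto simp: \<kappa>_def)
  have main: "\<exists>X. X \<subseteq> A \<and> X \<noteq> {} \<and> real (freiman_dim X) \<le> C * ln K \<and>
      real (card A) / real (card X) \<le> 1 * exp (C * (ln K)\<^sup>2)"
    if K: "K \<ge> 2" and A: "finite A" "A \<noteq> {}" and E: "real (additive_energy A) \<ge> real (card A) ^ 3 / K"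
    for K :: real and A :: "int set"
  proof -
    define \<theta> where "\<theta> = (\<kappa> ^ 4 / K) ^ 21 / 2 ^ 28"
    define L where "L = - ln \<theta>"
    have K0: "0 < K" using K by simp
    have \<theta>: "0 < \<theta>" unfolding \<theta>_def using \<kappa> K0 by simp
    have lnK: "ln 2 \<le> ln K" using K by simp
    have ln2: "1 / 2 \<le> ln (2 :: real)" using ln_le_minus_one[of "1 / 2 :: real"] by (simp add: ln_div)
    have L_eq: "L = 28 * ln 2 + 21 * ln K + 84 * ln (12500000000 :: real)"
    proof -
      have "ln \<theta> = 21 * (4 * ln \<kappa> - ln K) - 28 * ln 2"
        unfolding \<theta>_def using \<kappa>(1) K0 ln_realpow[of 2 28] by (simp add: ln_div ln_realpow)
      moreover have "ln \<kappa> = - ln 12500000000" by (simp add: \<kappa>_def ln_div)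
      ultimately show ?thesis by (simp add: L_def)
    qed
    \<comment> \<open>Comparison with \<open>2 ^ 34\<close> makes every term of \<open>L\<close> a
      multiple of \<open>ln 2\<close> or \<open>ln K\<close>, and \<open>K\<close> is at least
      2.\<close>
    have "ln (12500000000 :: real) \<le> ln (2 ^ 34)" by simp
    also have "\<dots> = 34 * ln (2 :: real)" using ln_realpow[of 2 34] by simp
    finally have L_le: "L \<le> 2905 * ln K" using L_eq lnK by linarith
    have "0 \<le> ln (12500000000 :: real)" by simp
    then have L1: "1 \<le> L" using L_eq lnK ln2 by linarith
    \<comment> \<open>The choice giving \<open>\<theta> powr \<epsilon> = exp (- \<kappa>)\<close>,
      which is at least \<open>1 - \<kappa>\<close>. Since \<open>L\<close> is
      \<open>O(ln K)\<close>, the size loss \<open>K powr (1 / \<epsilon>)\<close> is exponential in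
      the square of \<open>ln K\<close>.\<close>
    define \<epsilon> where "\<epsilon> = \<kappa> / L"
    have \<epsilon>: "0 < \<epsilon>" "\<epsilon> \<le> 1 / 2"
    proof -
      show "0 < \<epsilon>" using \<kappa> L1 by (simp add: \<epsilon>_def)
      have "\<epsilon> \<le> \<kappa> / 1" unfolding \<epsilon>_def using \<kappa> L1 by (intro divide_left_mono) auto
      then show "\<epsilon> \<le> 1 / 2" using \<kappa> by simp
    qed
    have "\<epsilon> * ln \<theta> = - \<kappa>" using L1 by (simp add: \<epsilon>_def L_def field_simps)
    then have "\<theta> powr \<epsilon> = exp (- \<kappa>)" using \<theta> by (simp add: powr_def)
    then have \<theta>\<epsilon>: "1 - \<kappa> \<le> \<theta> powr \<epsilon>" using exp_ge_add_one_self[of "- \<kappa>"] by simp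
    have "real (card A) ^ 3 \<le> K * real (additive_energy A)" using E K0 by (simp add: field_simps)
    then obtain X where X: "X \<subseteq> A" "X \<noteq> {}" "energy_extremal \<epsilon> X"
      "real (card X) ^ 3 \<le> K * real (additive_energy X)" "real (card A) / real (card X) \<le> K powr (1 / \<epsilon>)"
      using energy_extremal_subset_exists[OF A K0 _ \<epsilon>(1)] by blast
    have finX: "finite X" using X(1) A(1) by (rule finite_subset)
    have "real (freiman_dim X) \<le> C * ln K"
    proof (rule freiman_dim_le)
      \<comment> \<open>Every lattice model of \<open>X\<close> inherits extremality, so the bound
        holds for each admissible dimension at once.\<close>
      fix d B assume gen: "affinely_generates d B" and iso: "freiman_isomorphic X B"
      note B = energy_extremal_freiman_isomorphic[OF iso X(3)]
      have "0 < card B" using B(2) X(2) finX by (simp add: card_gt_0_iff)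
      then have finB: "finite B" "B \<noteq> {}" by (auto simp: card_gt_0_iff)
      have BL: "B \<subseteq> int_lattice d" using gen by (simp add: affinely_generates_def)
      have enB: "real (card B) ^ 3 \<le> K * real (additive_energy B)" using X(4) B(2,3) by simp
      have V: "0 \<in> bit_space d" "u \<in> bit_space d \<Longrightarrow> v \<in> bit_space d \<Longrightarrow> u - v \<in> bit_space d" for u v
        by (auto simp: bit_space_def)
      have PV: "parity ` B \<subseteq> bit_space d" using BL parity_in_bit_space by blast
      have double_inj: "x = y" if "x + x = y + y" for x y :: "nat \<Rightarrow> int"
      proof
        fix i show "x i = y i" using fun_cong[OF that, of i] by simp
      qed
      obtain y H where H: "H \<subseteq> bit_space d" "0 \<in> H" "\<And>u v. u \<in> H \<Longrightarrow> v \<in> H \<Longrightarrow> u - v \<in> H"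
        "\<And>a. a \<in> B \<Longrightarrow> parity a - y \<in> H" "real (card H) \<le> 2 / \<theta>"
        by (rule energy_extremal_in_small_coset[OF finB B(1) less_imp_le[OF \<epsilon>(1)] \<epsilon>(2) finite_bit_space V PV
            parity_diff parity_double double_inj K0 enB \<theta>_def[unfolded \<kappa>_def] \<theta>\<epsilon>[unfolded \<kappa>_def]],
            assumption+) blast
      have "bit_space d \<subseteq> H" by (rule affinely_generates_parity_coset[OF gen finB(2) H(2-4)])
      then have "H = bit_space d" using H(1) by blast
      then have "2 ^ d \<le> 2 / \<theta>" using H(5) by (simp add: card_bit_space)
      then have "ln (2 ^ d) \<le> ln (2 / \<theta>)" using \<theta> by (subst ln_le_cancel_iff) auto
      then have "real d * ln 2 \<le> ln 2 + L" using \<theta> by (simp add: ln_realpow ln_div L_def)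
      also have "\<dots> \<le> 2906 * ln K" using L_le lnK by simp
      finally have "real d * ln 2 \<le> 2906 * ln K" .
      moreover have "real d * (1 / 2) \<le> real d * ln 2" using ln2 by (intro mult_left_mono) auto
      ultimately have "real d \<le> 5812 * ln K" by linarith
      also have "\<dots> \<le> C * ln K" using lnK ln2 by (intro mult_right_mono) (auto simp: C_def \<kappa>_def)
      finally show "real d \<le> C * ln K" .
    next
      show "0 \<le> C * ln K" using lnK ln2 \<kappa> by (simp add: C_def)
    qed (rule finX)
    moreover have "real (card A) / real (card X) \<le> exp (C * (ln K)\<^sup>2)"
    proof -
      have "K powr (1 / \<epsilon>) = exp (ln K * L / \<kappa>)" using K0 by (simp add: powr_def \<epsilon>_def)
      also have "\<dots> \<le> exp (C * (ln K)\<^sup>2)"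
      proof -
        have "ln K * L \<le> ln K * (2905 * ln K)" using L_le lnK ln2 by (intro mult_left_mono) auto
        then have "ln K * L / \<kappa> \<le> ln K * (2905 * ln K) / \<kappa>" using \<kappa> by (intro divide_right_mono) auto
        then show ?thesis by (simp add: C_def power2_eq_square mult_ac)
      qed
      finally show ?thesis using X(5) by linarith
    qed
    ultimately show ?thesis using X(1,2) by auto
  qed
  have "C > 0" using \<kappa> by (simp add: C_def)
  then show ?thesis using main zero_less_one by blast
qed

end
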